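(* Let $\mathcal{C}$ be an extension-closed pseudovariety of finite groups and let $r,k\geq 1$ be integers. Then the free solvable group $S_{r,k}$ is $\mathcal{C}$-cyclic subgroup separable if and only if $\mathcal{C}$ contains all finite cyclic groups. In particular, $S_{r,k}$ is cyclic subgroup separable (i.e. $\mathcal{C}$-cyclic subgroup separable for $\mathcal{C}$ the class of all finite groups).
   Context: $S_{r,k} = F_r/F_r^{(k)}$, where $F_r$ is the free group of rank $r$ and $F_r^{(k)}$ is the $k$-th derived subgroup of $F_r$ ($F_r^{(0)}=F_r$, $F_r^{(i+1)}=[F_r^{(i)},F_r^{(i)}]$). An extension-closed pseudovariety of finite groups is a (non-empty, isomorphism-closed) class of finite groups closed under subgroups, finite direct products, quotients and extensions. For a group $G$, the pro-$\mathcal{C}$ topology has as base of open sets all cosets $gN$ with $g\in G$ and $N \unlhd G$, $G/N \in \mathcal{C}$. $G$ is $\mathcal{C}$-cyclic subgroup separable if every cyclic subgroup of $G$ (including the trivial one) is closed in the pro-$\mathcal{C}$ topology. *)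

theory Defs
  imports "HOL-Analysis.Abstract_Topology" "HOL-Algebra.Elementary_Groups"
begin

section \<open>Free groups and free solvable groups\<close>

text \<open>A letter \<open>(x, True)\<close> stands for the generator \<open>x\<close> and \<open>(x, False)\<close> for its inverse.
  Elements of the free group are the reduced words, multiplied by concatenation and
  free reduction.\<close>

type_synonym 'a letter = "'a \<times> bool"

definition inv_letter :: "'a letter \<Rightarrow> 'a letter" where
  "inv_letter a = (fst a, \<not> snd a)"

definition reduced :: "'a letter list \<Rightarrow> bool" where
  "reduced w \<longleftrightarrow> successively (\<lambda>a b. b \<noteq> inv_letter a) w"

text \<open>The reduced form of \<open>a # w\<close>, for a reduced word \<open>w\<close>.\<close>

fun push :: "'a letter \<Rightarrow> 'a letter list \<Rightarrow> 'a letter list" where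
  "push a [] = [a]"
| "push a (b # w) = (if b = inv_letter a then w else a # b # w)"

definition free_group :: "'a set \<Rightarrow> 'a letter list monoid" where
  "free_group X =
    \<lparr>carrier = {w. fst ` set w \<subseteq> X \<and> reduced w}, mult = foldr push, one = []\<rparr>"

text \<open>The derived subgroup operator \<^const>\<open>derived\<close> is iterated inside the free group.\<close>

definition free_solvable_group :: "nat \<Rightarrow> nat \<Rightarrow> nat letter list set monoid" where
  "free_solvable_group r k =
    (let F = free_group {..<r} in F Mod ((derived F ^^ k) (carrier F)))"

lemma inv_letter_simps [simp]:
  "inv_letter (inv_letter a) = a" "fst (inv_letter a) = fst a"
  "inv_letter a \<noteq> a" "a \<noteq> inv_letter a" "inv_letter a = inv_letter b \<longleftrightarrow> a = b"
  by (auto simp: inv_letter_def prod_eq_iff)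

lemma reduced_simps [simp]:
  "reduced []" "reduced [a]"
  "reduced (a # b # w) \<longleftrightarrow> b \<noteq> inv_letter a \<and> reduced (b # w)"
  by (auto simp: reduced_def)

lemma reduced_tl: "reduced (a # w) \<Longrightarrow> reduced w"
  by (cases w) auto

lemma reduced_push: "reduced w \<Longrightarrow> reduced (push a w)"
  by (cases w) (auto dest: reduced_tl)

lemma reduced_foldr_push: "reduced w \<Longrightarrow> reduced (foldr push u w)"
  by (induction u) (auto simp: reduced_push)

lemma push_push_inv:
  assumes "reduced w"
  shows "push a (push (inv_letter a) w) = w"
proof (cases w)
  case (Cons b v)
  then show ?thesis using assms by (cases v) auto
qed simp

lemma foldr_push_push:
  assumes "reduced v"
  shows "foldr push (push a u) v = push a (foldr push u v)"
proof (cases u)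
  case (Cons b u')
  then show ?thesis
    by (simp add: push_push_inv reduced_foldr_push assms)
qed simp

lemma foldr_push_assoc:
  "reduced w \<Longrightarrow> foldr push (foldr push u v) w = foldr push u (foldr push v w)"
  by (induction u) (auto simp: foldr_push_push)

lemma foldr_push_reduced: "reduced u \<Longrightarrow> foldr push u [] = u"
proof (induction u)
  case (Cons a u)
  then show ?case by (cases u) auto
qed auto

lemma fst_set_foldr_push: "fst ` set (foldr push u v) \<subseteq> fst ` set u \<union> fst ` set v"
proof (induction u)
  case (Cons a u)
  have "set (push a w) \<subseteq> insert a (set w)" for w
    by (cases w) auto
  from image_mono[OF this, of fst] Cons show ?case by (simp add: subset_iff) blast
qed auto

lemma foldr_push_left_inverse:
  "reduced v \<Longrightarrow> foldr push (map inv_letter (rev u)) (foldr push u v) = v"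
proof (induction u arbitrary: v)
  case (Cons a u)
  then show ?case
    using push_push_inv[OF reduced_foldr_push, of v "inv_letter a" u] by auto
qed auto

lemma reduced_inverse:
  assumes "reduced u"
  shows "reduced (map inv_letter (rev u))"
proof -
  have "inv_letter x \<noteq> y" if "y \<noteq> inv_letter x" for x y :: "'a letter"
    using that by auto
  moreover have "x \<noteq> inv_letter y" if "y \<noteq> inv_letter x" for x y :: "'a letter"
    using that by auto
  ultimately show ?thesis
    using assms unfolding reduced_def successively_map successively_rev rev_map
    by (auto elim!: successively_mono)
qed

lemma group_free_group: "group (free_group X)"
proof (rule groupI)
  fix x assume "x \<in> carrier (free_group X)"
  then show "\<exists>y\<in>carrier (free_group X). y \<otimes>\<^bsub>free_group X\<^esub> x = \<one>\<^bsub>free_group X\<^esub>"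
    using foldr_push_left_inverse[of "[]" x]
    by (intro bexI[of _ "map inv_letter (rev x)"])
       (auto simp: free_group_def foldr_push_reduced image_image reduced_inverse)
next
  fix x y assume "x \<in> carrier (free_group X)" "y \<in> carrier (free_group X)"
  then have "fst ` set (foldr push x y) \<subseteq> X" "reduced (foldr push x y)"
    using subset_trans[OF fst_set_foldr_push[of x y], of X]
    by (simp_all add: free_group_def reduced_foldr_push)
  then show "x \<otimes>\<^bsub>free_group X\<^esub> y \<in> carrier (free_group X)"
    by (simp add: free_group_def)
qed (auto simp: free_group_def foldr_push_assoc)

section \<open>Pseudovarieties of finite groups\<close>

text \<open>Every finite group is isomorphic to one whose elements are natural numbers. An
  isomorphism-closed class of finite groups is therefore given by its members of type
  \<^typ>\<open>nat monoid\<close>; a group with elements of another type belongs to the class if it is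
  isomorphic to one of these.\<close>

definition in_class :: "nat monoid set \<Rightarrow> 'a monoid \<Rightarrow> bool" where
  "in_class \<C> G \<longleftrightarrow> group G \<and> (\<exists>H\<in>\<C>. H \<cong> G)"

text \<open>Binary products suffice in \<open>direct_product\<close>: the trivial group, which is the empty
  product, is a subgroup of any member. An extension of finite groups is finite, so
  \<open>extension\<close> does not require \<open>G\<close> to be finite.\<close>

locale extension_closed_pseudovariety =
  fixes \<C> :: "nat monoid set"
  assumes nonempty: "\<C> \<noteq> {}"
    and is_group: "G \<in> \<C> \<Longrightarrow> group G"
    and is_finite: "G \<in> \<C> \<Longrightarrow> finite (carrier G)"
    and isomorphic: "\<lbrakk>G \<in> \<C>; group H; G \<cong> H\<rbrakk> \<Longrightarrow> H \<in> \<C>"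
    and subgroup: "\<lbrakk>G \<in> \<C>; subgroup K G\<rbrakk> \<Longrightarrow> G\<lparr>carrier := K\<rparr> \<in> \<C>"
    and direct_product: "\<lbrakk>G \<in> \<C>; H \<in> \<C>\<rbrakk> \<Longrightarrow> in_class \<C> (G \<times>\<times> H)"
    and quotient: "\<lbrakk>G \<in> \<C>; N \<lhd> G\<rbrakk> \<Longrightarrow> in_class \<C> (G Mod N)"
    and extension: "\<lbrakk>group G; N \<lhd> G; G\<lparr>carrier := N\<rparr> \<in> \<C>; in_class \<C> (G Mod N)\<rbrakk>
      \<Longrightarrow> G \<in> \<C>"

definition finite_groups :: "nat monoid set" where
  "finite_groups = {G. group G \<and> finite (carrier G)}"

definition finite_cyclic_groups :: "nat monoid set" where
  "finite_cyclic_groups = {G. group G \<and> finite (carrier G) \<and> cyclic_group G}"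

section \<open>The pro-\<open>\<C>\<close> topology\<close>

definition pro_basic :: "nat monoid set \<Rightarrow> 'a monoid \<Rightarrow> 'a set \<Rightarrow> bool" where
  "pro_basic \<C> G U \<longleftrightarrow>
    (\<exists>g N. g \<in> carrier G \<and> N \<lhd> G \<and> in_class \<C> (G Mod N) \<and> U = g <#\<^bsub>G\<^esub> N)"

text \<open>These sets form a base if \<open>\<C>\<close> is a pseudovariety, see \<open>openin_pro_topology\<close> below.\<close>

definition pro_topology :: "nat monoid set \<Rightarrow> 'a monoid \<Rightarrow> 'a topology" where
  "pro_topology \<C> G = topology (arbitrary union_of pro_basic \<C> G)"

definition cyclic_subgroup_separable :: "nat monoid set \<Rightarrow> 'a monoid \<Rightarrow> bool" where
  "cyclic_subgroup_separable \<C> G \<longleftrightarrow>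
    (\<forall>g\<in>carrier G. closedin (pro_topology \<C> G) (generate G {g}))"

lemma in_class_Mod_hom:
  assumes "in_class \<C> (G Mod N)" "N \<lhd> G" "\<And>H. H \<in> \<C> \<Longrightarrow> group H"
  obtains H f where "H \<in> \<C>" "f \<in> hom G H" "kernel G H f = N"
proof -
  interpret N: normal N G by fact
  obtain H where H: "H \<in> \<C>" "H \<cong> G Mod N"
    using assms(1) by (auto simp: in_class_def)
  interpret H: group H using H assms(3) by blast
  obtain h where h: "h \<in> iso (G Mod N) H"
    using H.iso_sym[OF H(2)] by (auto simp: is_iso_def)
  define f where "f = (\<lambda>a. h (N #>\<^bsub>G\<^esub> a))"
  have "f \<in> hom G H"
    using hom_compose[OF N.r_coset_hom_Mod, of h H] h by (simp add: f_def iso_def o_def)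
  moreover have "kernel G H f = N"
  proof -
    have "h N = \<one>\<^bsub>H\<^esub>"
      using hom_one[of h "G Mod N" H] h N.factorgroup_is_group H.is_group
      by (simp add: iso_def)
    moreover have "N \<in> carrier (G Mod N)"
      using group.is_monoid[OF N.factorgroup_is_group] monoid.one_closed by fastforce
    moreover have "N #>\<^bsub>G\<^esub> a \<in> carrier (G Mod N)" if "a \<in> carrier G" for a
      using that by (auto simp: carrier_FactGroup)
    moreover have "inj_on h (carrier (G Mod N))"
      using h by (simp add: iso_def bij_betw_def)
    ultimately have *: "f a = \<one>\<^bsub>H\<^esub> \<longleftrightarrow> N #>\<^bsub>G\<^esub> a = N" if "a \<in> carrier G" for a
      using that inj_on_eq_iff[of h "carrier (G Mod N)" "N #>\<^bsub>G\<^esub> a" N] by (simp add: f_def)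
    have "f a = \<one>\<^bsub>H\<^esub> \<longleftrightarrow> a \<in> N" if "a \<in> carrier G" for a
      using *[OF that] N.coset_join1[OF _ that] N.coset_join2[OF that] N.subgroup_axioms by blast
    then show ?thesis
      using N.subset by (auto simp: kernel_def)
  qed
  ultimately show ?thesis using that H by blast
qed

context extension_closed_pseudovariety
begin

lemma in_class_Mod_Int:
  assumes "N \<lhd> G" "M \<lhd> G" "in_class \<C> (G Mod N)" "in_class \<C> (G Mod M)"
  shows "in_class \<C> (G Mod (N \<inter> M))"
proof -
  obtain A f where A: "A \<in> \<C>" "f \<in> hom G A" "kernel G A f = N"
    using in_class_Mod_hom[OF assms(3,1) is_group] by blast
  obtain B g where B: "B \<in> \<C>" "g \<in> hom G B" "kernel G B g = M"
    using in_class_Mod_hom[OF assms(4,2) is_group] by blast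
  interpret A: group A using A is_group by blast
  interpret B: group B using B is_group by blast
  interpret N: normal N G by fact
  interpret M: normal M G by fact
  obtain P where P: "P \<in> \<C>" "P \<cong> A \<times>\<times> B"
    using direct_product[OF A(1) B(1)] by (auto simp: in_class_def)
  interpret P: group P using P is_group by blast
  obtain h where h: "h \<in> iso (A \<times>\<times> B) P"
    using P.iso_sym[OF P(2)] by (auto simp: is_iso_def)
  define F where "F = (\<lambda>x. h (f x, g x))"
  have "(\<lambda>x. (f x, g x)) \<in> hom G (A \<times>\<times> B)"
    using A(2) B(2) by (auto simp: hom_def)
  then have F: "F \<in> hom G P"
    using hom_compose[of "\<lambda>x. (f x, g x)" G "A \<times>\<times> B" h P] h
    by (simp add: F_def iso_def o_def)
  interpret F: group_hom G P F
    by unfold_locales (rule F)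
  have AB: "group (A \<times>\<times> B)" by (rule DirProd_group) unfold_locales
  have "h (\<one>\<^bsub>A\<^esub>, \<one>\<^bsub>B\<^esub>) = \<one>\<^bsub>P\<^esub>"
    using hom_one[of h "A \<times>\<times> B" P] h AB P.is_group by (simp add: iso_def)
  moreover have "f x \<in> carrier A" "g x \<in> carrier B" if "x \<in> carrier G" for x
    using that A(2) B(2) by (auto simp: hom_def)
  moreover have "inj_on h (carrier (A \<times>\<times> B))"
    using h by (simp add: iso_def bij_betw_def)
  ultimately have "F x = \<one>\<^bsub>P\<^esub> \<longleftrightarrow> f x = \<one>\<^bsub>A\<^esub> \<and> g x = \<one>\<^bsub>B\<^esub>" if "x \<in> carrier G" for x
    using that inj_on_eq_iff[of h "carrier (A \<times>\<times> B)" "(f x, g x)" "(\<one>\<^bsub>A\<^esub>, \<one>\<^bsub>B\<^esub>)"]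
    by (simp add: F_def)
  then have ker: "kernel G P F = N \<inter> M"
    using A(3) B(3) by (auto simp: kernel_def)
  define I where "I = P\<lparr>carrier := F ` carrier G\<rparr>"
  have I: "I \<in> \<C>"
    unfolding I_def by (rule subgroup[OF P(1)]) (rule F.img_is_subgroup)
  interpret I: group I using I is_group by blast
  have "F \<in> hom G I"
    using F by (auto simp: I_def hom_def)
  then interpret FI: group_hom G I F
    by unfold_locales
  have "kernel G I F = N \<inter> M"
    using ker by (simp add: kernel_def I_def)
  moreover have "F ` carrier G = carrier I"
    by (simp add: I_def)
  ultimately have iso: "G Mod (N \<inter> M) \<cong> I" "N \<inter> M \<lhd> G"
    using FI.FactGroup_iso FI.normal_kernel by simp_all
  have grp: "group (G Mod (N \<inter> M))"
    by (rule normal.factorgroup_is_group[OF iso(2)])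
  show ?thesis
    using I grp group.iso_sym[OF grp iso(1)] unfolding in_class_def by blast
qed

lemma openin_pro_topology:
  "openin (pro_topology \<C> G) = arbitrary union_of pro_basic \<C> G"
  unfolding pro_topology_def
proof (rule topology_inverse', rule istopology_base_eq[THEN iffD2], intro allI impI)
  fix S T assume "pro_basic \<C> G S \<and> pro_basic \<C> G T"
  then obtain g N h M where
    S: "g \<in> carrier G" "N \<lhd> G" "in_class \<C> (G Mod N)" "S = g <#\<^bsub>G\<^esub> N" and
    T: "h \<in> carrier G" "M \<lhd> G" "in_class \<C> (G Mod M)" "T = h <#\<^bsub>G\<^esub> M"
    by (auto simp: pro_basic_def)
  interpret N: normal N G by fact
  interpret M: normal M G by fact
  have NM: "N \<inter> M \<lhd> G"
    using S(2) T(2) N.subgroups_Inter_pair[OF N.subgroup_axioms M.subgroup_axioms]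
    unfolding N.normal_inv_iff by blast
  interpret NM: normal "N \<inter> M" G by (rule NM)
  have cover: "x <#\<^bsub>G\<^esub> (N \<inter> M) \<subseteq> S \<inter> T \<and> x \<in> x <#\<^bsub>G\<^esub> (N \<inter> M) \<and> x \<in> carrier G"
    if x: "x \<in> S \<inter> T" for x
  proof -
    have xG: "x \<in> carrier G"
      using x S N.l_coset_subset_G[OF N.subset] by blast
    have "S = x <#\<^bsub>G\<^esub> N"
      using x S N.l_repr_independence[OF _ S(1) N.subgroup_axioms] by blast
    moreover have "T = x <#\<^bsub>G\<^esub> M"
      using x T N.l_repr_independence[OF _ T(1) M.subgroup_axioms] by blast
    moreover have "x = x \<otimes>\<^bsub>G\<^esub> \<one>\<^bsub>G\<^esub>"
      using xG by simp
    ultimately show ?thesis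
      using xG NM.one_closed unfolding l_coset_def by blast
  qed
  have "S \<inter> T = \<Union> ((\<lambda>x. x <#\<^bsub>G\<^esub> (N \<inter> M)) ` (S \<inter> T))"
    using cover by blast
  moreover have "pro_basic \<C> G (x <#\<^bsub>G\<^esub> (N \<inter> M))" if "x \<in> S \<inter> T" for x
    using cover[OF that] in_class_Mod_Int[OF S(2) T(2) S(3) T(3)] NM
    unfolding pro_basic_def by blast
  ultimately show "(arbitrary union_of pro_basic \<C> G) (S \<inter> T)"
    unfolding union_of_def arbitrary_def
    by (intro exI[of _ "(\<lambda>x. x <#\<^bsub>G\<^esub> (N \<inter> M)) ` (S \<inter> T)"]) blast
qed

end

end

theory Submission
  imports Defs "HOL-Algebra.Multiplicative_Group"
begin

text \<open>For a normal subgroup N of a free group F, a word traces a path in the Cayley graph of F/N.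
  Recording how often it traverses each edge, counted with orientation, is a crossed homomorphism
  from F to the integral 1-chains, and its kernel on N is exactly the derived subgroup N'
  (Magnus). Hence F/N' inherits torsion-freeness from F/N. It also inherits separability of cyclic
  subgroups: after translating by a power of g one has to separate some u in N from the powers
  of g. Choose M containing N with F/M in the class such that M distinguishes the finitely many
  vertices that matter, and reduce the 1-chains of F/M modulo n; the kernel K of this reduction in M
  has F/K in the class, as M/K is a subgroup of a power of Z/n. If g lies in N, then the multiples of
  one chain must avoid another chain modulo n. Otherwise u = g^i modulo K would make the chain of u
  invariant under g, which contradicts the finiteness of its support once the order of g modulo M
  is large.

  Conversely, if x has infinite order and the subgroups generated by its powers are closed, then in
  a suitable quotient in the class the order of x is a multiple of n, for every given n.\<close>

section \<open>Extension-closed pseudovarieties\<close>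

lemma in_class_iso:
  assumes "in_class \<C> G" "G \<cong> H" "group H"
  shows "in_class \<C> H"
  using assms iso_trans unfolding in_class_def by blast

lemma in_class_self: "G \<in> \<C> \<Longrightarrow> group G \<Longrightarrow> in_class \<C> G"
  unfolding in_class_def using iso_refl by blast

text \<open>The class itself consists of groups on \<open>nat\<close>; such copies bring finite
  groups over other types, for instance quotients, within its reach.\<close>

lemma (in group) ex_nat_group_iso:
  assumes "finite (carrier G)"
  obtains H :: "nat monoid" where "group H" "H \<cong> G"
proof -
  obtain f :: "'a \<Rightarrow> nat" where f: "inj_on f (carrier G)"
    using finite_imp_inj_to_nat_seg[OF assms] by blast
  define g where "g = inv_into (carrier G) f"
  define H where "H = \<lparr>carrier = f ` carrier G, mult = (\<lambda>x y. f (g x \<otimes> g y)), one = f \<one>\<rparr>"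
  have "f \<in> iso G H"
    using f by (auto simp: iso_def hom_def bij_betw_def H_def g_def)
  then have "group H" "G \<cong> H"
    using iso_imp_img_group[of f H] by (auto simp: H_def is_iso_def)
  then show thesis
    using that iso_sym by blast
qed

text \<open>The composite of the two projections from G is surjective with kernel \<open>M\<close>.
  The set of cosets of \<open>K\<close> in \<open>M\<close> is M/K, viewed inside G/K.\<close>

lemma (in group) third_isomorphism:
  assumes K: "K \<lhd> G" and M: "M \<lhd> G" and "K \<subseteq> M"
  shows "G Mod M \<cong> G Mod K Mod (rcosets\<^bsub>G\<lparr>carrier := M\<rparr>\<^esub> K)"
proof -
  let ?R = "rcosets\<^bsub>G\<lparr>carrier := M\<rparr>\<^esub> K"
  interpret K: normal K G by fact
  interpret M: normal M G by fact
  interpret R: normal ?R "G Mod K"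
    using normality_factorization[OF K \<open>K \<subseteq> M\<close> M] .
  interpret Q: group "G Mod K Mod ?R" by (rule R.factorgroup_is_group)
  define f where "f = (\<lambda>x. ?R #>\<^bsub>G Mod K\<^esub> (K #> x))"
  have "f \<in> hom G (G Mod K Mod ?R)"
    using Group.hom_compose[OF K.r_coset_hom_Mod R.r_coset_hom_Mod] unfolding f_def o_def .
  then interpret f: group_hom G "G Mod K Mod ?R" f
    by unfold_locales
  have *: "K #> x \<in> carrier (G Mod K)" if "x \<in> carrier G" for x
    using that by (simp add: carrier_FactGroup)
  have "f x = ?R \<longleftrightarrow> x \<in> M" if x: "x \<in> carrier G" for x
  proof -
    have "f x = ?R \<longleftrightarrow> K #> x \<in> ?R"
      unfolding f_def
      using R.coset_join1[OF _ *[OF x] R.subgroup_axioms] R.coset_join2[OF *[OF x] R.subgroup_axioms] R.subset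
      by blast
    also have "\<dots> \<longleftrightarrow> x \<in> M"
    proof
      assume "K #> x \<in> ?R"
      then obtain m where m: "m \<in> M" "K #> x = K #> m"
        by (auto simp: RCOSETS_def)
      then have "x \<in> K #> m"
        using rcos_self[OF x K.subgroup_axioms] by simp
      then show "x \<in> M"
        using m(1) \<open>K \<subseteq> M\<close> M.m_closed unfolding r_coset_def by blast
    qed (auto simp: RCOSETS_def)
    finally show ?thesis .
  qed
  then have "kernel G (G Mod K Mod ?R) f = M"
    using M.subset by (auto simp: kernel_def)
  moreover have "f ` carrier G = carrier (G Mod K Mod ?R)"
    by (auto simp: f_def carrier_FactGroup)
  ultimately show ?thesis
    using f.FactGroup_iso by simp
qed

lemma (in group) mon_integer_mod_group_pow:
  assumes "x \<in> carrier G" "ord x > 0"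
  shows "(\<lambda>i. x [^] i) \<in> mon (integer_mod_group (ord x)) G"
proof -
  have eq: "x [^] i = x [^] j \<longleftrightarrow> i mod int (ord x) = j mod int (ord x)" for i j :: int
    using int_pow_eq[OF assms(1), of i j] by (metis mod_eq_dvd_iff dvd_diff_commute)
  show ?thesis
    using assms by (auto simp: mon_def hom_def inj_on_def eq carrier_integer_mod_group simp flip: int_pow_mult)
qed

section \<open>Closure properties of the class for groups of arbitrary element type\<close>

context extension_closed_pseudovariety
begin

lemma in_class_finite: "in_class \<C> G \<Longrightarrow> finite (carrier G)"
  using is_finite iso_finite unfolding in_class_def by blast

lemma in_class_subgroup:
  assumes "in_class \<C> G" "subgroup K G"
  shows "in_class \<C> (G\<lparr>carrier := K\<rparr>)"
proof -
  obtain H where H: "H \<in> \<C>" "H \<cong> G" and G: "group G"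
    using assms(1) by (auto simp: in_class_def)
  have "group H" by (rule is_group) (rule H)
  have "G \<cong> H" using group.iso_sym[OF \<open>group H\<close> H(2)] .
  then obtain f where f: "f \<in> iso G H" by (auto simp: is_iso_def)
  have sub: "subgroup (f ` K) H"
    by (rule subgroup.iso_subgroup[OF assms(2) G \<open>group H\<close> f])
  have "G\<lparr>carrier := K\<rparr> \<cong> H\<lparr>carrier := f ` K\<rparr>"
    using iso_restrict[OF f G \<open>group H\<close> assms(2)] by (rule is_isoI)
  moreover have GK: "group (G\<lparr>carrier := K\<rparr>)"
    using G assms(2) by (simp add: group.subgroup_imp_group)
  ultimately have "H\<lparr>carrier := f ` K\<rparr> \<cong> G\<lparr>carrier := K\<rparr>"
    using group.iso_sym by blast
  then show ?thesis
    using subgroup[OF H(1) sub] GK unfolding in_class_def by blast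
qed

text \<open>By the first isomorphism theorem the quotient is a copy of the image of
  \<open>f\<close>, a subgroup of \<open>H\<close>.\<close>

lemma in_class_Mod_kernel:
  assumes "group_hom G H f" "in_class \<C> H"
  shows "in_class \<C> (G Mod kernel G H f)"
proof -
  interpret f: group_hom G H f by fact
  let ?I = "H\<lparr>carrier := f ` carrier G\<rparr>"
  have I: "in_class \<C> ?I"
    by (rule in_class_subgroup[OF assms(2) f.img_is_subgroup])
  then interpret I: group ?I by (simp add: in_class_def)
  interpret fI: group_hom G ?I f
    by unfold_locales (auto simp: hom_def)
  have "kernel G ?I f = kernel G H f"
    by (simp add: kernel_def)
  then have "G Mod kernel G H f \<cong> ?I" "kernel G H f \<lhd> G"
    using fI.FactGroup_iso fI.normal_kernel by simp_all
  then show ?thesis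
    using in_class_iso[OF I] group.iso_sym normal.factorgroup_is_group by blast
qed

lemma in_class_mon:
  assumes "f \<in> mon G H" "group G" "in_class \<C> H"
  shows "in_class \<C> G"
proof -
  interpret f: group_hom G H f
    using assms by (simp add: group_hom_def group_hom_axioms_def mon_def in_class_def)
  have "kernel G H f = {\<one>\<^bsub>G\<^esub>}"
    using assms(1) f.inj_iff_trivial_ker by (simp add: mon_def)
  then have "in_class \<C> (G Mod {\<one>\<^bsub>G\<^esub>})"
    using in_class_Mod_kernel[OF f.group_hom_axioms assms(3)] by simp
  then show ?thesis
    using in_class_iso[OF _ is_isoI[OF group.trivial_factor_iso[OF assms(2)]] assms(2)] by blast
qed

text \<open>The axiom \<open>extension\<close> speaks of groups on \<open>nat\<close> only. As a
  finite union of finite cosets \<open>G\<close> is finite, so it has such a copy \<open>H\<close>,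
  to which \<open>N\<close> is pulled back.\<close>

lemma in_class_extension:
  assumes "N \<lhd> G" "in_class \<C> (G\<lparr>carrier := N\<rparr>)" "in_class \<C> (G Mod N)"
  shows "in_class \<C> G"
proof -
  interpret N: normal N G by fact
  have "finite N" "finite (carrier (G Mod N))"
    using in_class_finite[OF assms(2)] in_class_finite[OF assms(3)] by simp_all
  have "finite (carrier G)"
  proof -
    have "carrier G = \<Union> (carrier (G Mod N))"
      using N.rcosets_part_G[OF N.subgroup_axioms] by (simp add: FactGroup_def)
    moreover have "finite c" if "c \<in> carrier (G Mod N)" for c
      using that \<open>finite N\<close> by (auto simp: carrier_FactGroup r_coset_def)
    ultimately show ?thesis
      using \<open>finite (carrier (G Mod N))\<close> by auto
  qed
  then obtain H :: "nat monoid" where H: "group H" "H \<cong> G"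
    using N.ex_nat_group_iso by blast
  interpret H: group H by fact
  obtain e where e: "e \<in> iso H G"
    using H(2) by (auto simp: is_iso_def)
  interpret e: group_hom H "G" e
    using e by unfold_locales (simp add: iso_def)
  \<comment> \<open>The preimage of \<open>N\<close>; it is normal as the kernel of the map from
    \<open>H\<close> to G/N.\<close>
  define L where "L = {x \<in> carrier H. e x \<in> N}"
  have im: "e ` L = N"
  proof -
    have "e ` carrier H = carrier G" using e by (simp add: iso_iff)
    then have "\<exists>x\<in>L. n = e x" if "n \<in> N" for n
      using that N.subset unfolding L_def by (metis (no_types, lifting) imageE mem_Collect_eq subsetD)
    then show ?thesis by (auto simp: L_def)
  qed
  interpret Q: group "G Mod N" by (rule N.factorgroup_is_group)
  have "(\<lambda>x. N #>\<^bsub>G\<^esub> e x) \<in> hom H (G Mod N)"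
    using hom_compose[OF e.homh N.r_coset_hom_Mod] by (simp add: o_def)
  then interpret q: group_hom H "G Mod N" "\<lambda>x. N #>\<^bsub>G\<^esub> e x"
    by unfold_locales
  have "N #>\<^bsub>G\<^esub> x = N \<longleftrightarrow> x \<in> N" if "x \<in> carrier G" for x
    using that N.coset_join1 N.coset_join2 N.subset N.subgroup_axioms by blast
  then have ker: "kernel H (G Mod N) (\<lambda>x. N #>\<^bsub>G\<^esub> e x) = L"
    unfolding kernel_def L_def one_FactGroup using e.hom_closed by (intro Collect_cong) metis
  have L: "L \<lhd> H"
    using q.normal_kernel by (simp add: ker)
  have "in_class \<C> (H Mod L)"
    using in_class_Mod_kernel[OF q.group_hom_axioms assms(3)] by (simp add: ker)
  moreover have "H\<lparr>carrier := L\<rparr> \<cong> G\<lparr>carrier := N\<rparr>"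
    using iso_restrict[OF e H.is_group N.is_group normal_imp_subgroup[OF L]]
    by (simp add: im is_isoI)
  then have "in_class \<C> (H\<lparr>carrier := L\<rparr>)"
    using in_class_iso[OF assms(2)] group.iso_sym H.subgroup_imp_group normal_imp_subgroup[OF L]
    by blast
  then have "H\<lparr>carrier := L\<rparr> \<in> \<C>"
    using isomorphic unfolding in_class_def by blast
  ultimately have "H \<in> \<C>"
    using extension[OF H(1) L] by blast
  then show ?thesis
    using H(2) N.is_group by (auto simp: in_class_def)
qed

text \<open>G/K is an extension of G/M by M/K.\<close>

lemma in_class_Mod_extension:
  assumes "K \<lhd> G" "M \<lhd> G" "K \<subseteq> M"
    and "in_class \<C> (G Mod M)" "in_class \<C> (G\<lparr>carrier := M\<rparr> Mod K)"
  shows "in_class \<C> (G Mod K)"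
proof -
  interpret M: normal M G by fact
  let ?R = "rcosets\<^bsub>G\<lparr>carrier := M\<rparr>\<^esub> K"
  have R: "?R \<lhd> G Mod K"
    by (rule M.normality_factorization[OF assms(1,3,2)])
  \<comment> \<open>M/K occurs both as a quotient of \<open>M\<close> and as a subgroup of G/K; the
    two records differ only in the group whose set product they use.\<close>
  moreover have "set_mult (G\<lparr>carrier := M\<rparr>) = set_mult G"
    by (intro ext) simp
  then have "in_class \<C> ((G Mod K)\<lparr>carrier := ?R\<rparr>)"
    using assms(5) by (simp add: FactGroup_def)
  moreover have "in_class \<C> (G Mod K Mod ?R)"
    using in_class_iso[OF assms(4) M.third_isomorphism[OF assms(1,2,3)]]
      normal.factorgroup_is_group[OF R] .
  ultimately show ?thesis
    by (rule in_class_extension)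
qed

lemma in_class_Mod_carrier:
  assumes "group G"
  shows "in_class \<C> (G Mod carrier G)"
proof -
  interpret G: group G by fact
  obtain H where H: "H \<in> \<C>" using nonempty by blast
  interpret H: group H using is_group[OF H] .
  have h: "group_hom G H (\<lambda>_. \<one>\<^bsub>H\<^esub>)"
    by (intro group_hom.intro group_hom_axioms.intro homI) (simp_all add: assms H.is_group)
  have "kernel G H (\<lambda>_. \<one>\<^bsub>H\<^esub>) = carrier G"
    by (auto simp: kernel_def)
  then show ?thesis
    using in_class_Mod_kernel[OF h in_class_self[OF H H.is_group]] by simp
qed

text \<open>Intersecting with \<open>carrier G\<close> takes care of empty \<open>I\<close>, where
  the family alone would intersect to the whole type.\<close>

lemma in_class_Mod_INT:
  assumes "finite I" "group G" and "\<And>i. i \<in> I \<Longrightarrow> N i \<lhd> G \<and> in_class \<C> (G Mod N i)"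
  shows "(carrier G \<inter> (\<Inter>i\<in>I. N i)) \<lhd> G \<and> in_class \<C> (G Mod (carrier G \<inter> (\<Inter>i\<in>I. N i)))"
  using assms(1,3)
proof (induction I)
  case empty
  then show ?case
    using in_class_Mod_carrier[OF assms(2)] group.normal_self[OF assms(2)] by simp
next
  case (insert i I)
  interpret group G by fact
  let ?M = "carrier G \<inter> (\<Inter>i\<in>I. N i)"
  have M: "?M \<lhd> G" "in_class \<C> (G Mod ?M)" "N i \<lhd> G" "in_class \<C> (G Mod N i)"
    using insert by auto
  have "N i \<inter> ?M \<lhd> G"
    by (rule normal_subgroup_intersect) (use M in auto)
  moreover have "in_class \<C> (G Mod (N i \<inter> ?M))"
    by (rule in_class_Mod_Int) (use M in auto)
  moreover have "N i \<inter> ?M = carrier G \<inter> (\<Inter>i\<in>insert i I. N i)"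
    by auto
  ultimately show ?case by simp
qed

section \<open>Open and closed sets of the pro-C topology\<close>

lemma closedin_pro_topology_iff:
  assumes "group G"
  shows "closedin (pro_topology \<C> G) S \<longleftrightarrow> S \<subseteq> carrier G \<and>
    (\<forall>h\<in>carrier G - S. \<exists>N. N \<lhd> G \<and> in_class \<C> (G Mod N) \<and> (h <#\<^bsub>G\<^esub> N) \<inter> S = {})"
proof -
  interpret group G by fact
  have sub: "U \<subseteq> carrier G" if "pro_basic \<C> G U" for U
    using that l_coset_subset_G normal_imp_subgroup subgroup.subset unfolding pro_basic_def by metis
  have self: "h \<in> h <#\<^bsub>G\<^esub> N" if "h \<in> carrier G" "N \<lhd> G" for h N
  proof -
    have "\<one>\<^bsub>G\<^esub> \<in> N" "h = h \<otimes>\<^bsub>G\<^esub> \<one>\<^bsub>G\<^esub>"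
      using that normal_imp_subgroup subgroup.one_closed by auto
    then show ?thesis unfolding l_coset_def by blast
  qed
  \<comment> \<open>A basic open set that contains \<open>h\<close> is itself a left coset with
    representative \<open>h\<close>, so only cosets of this form need testing.\<close>
  have openin: "openin (pro_topology \<C> G) V \<longleftrightarrow> V \<subseteq> carrier G \<and>
    (\<forall>h\<in>V. \<exists>N. N \<lhd> G \<and> in_class \<C> (G Mod N) \<and> (h <#\<^bsub>G\<^esub> N) \<subseteq> V)" for V
  proof
    assume "openin (pro_topology \<C> G) V"
    then obtain \<U> where \<U>: "\<And>U. U \<in> \<U> \<Longrightarrow> pro_basic \<C> G U" "V = \<Union> \<U>"
      unfolding openin_pro_topology union_of_def arbitrary_def by auto
    have "\<exists>N. N \<lhd> G \<and> in_class \<C> (G Mod N) \<and> h <#\<^bsub>G\<^esub> N \<subseteq> V" if h: "h \<in> V" for h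
    proof -
      obtain U where U: "U \<in> \<U>" "h \<in> U" using h \<U> by blast
      obtain g N where N: "g \<in> carrier G" "N \<lhd> G" "in_class \<C> (G Mod N)" "U = g <#\<^bsub>G\<^esub> N"
        using \<U>(1)[OF U(1)] unfolding pro_basic_def by blast
      have "U = h <#\<^bsub>G\<^esub> N"
        using l_repr_independence[of h g N] U(2) N normal_imp_subgroup by metis
      then show ?thesis using N U \<U> by blast
    qed
    moreover have "V \<subseteq> carrier G"
      using \<U> sub by blast
    ultimately show "V \<subseteq> carrier G \<and>
        (\<forall>h\<in>V. \<exists>N. N \<lhd> G \<and> in_class \<C> (G Mod N) \<and> (h <#\<^bsub>G\<^esub> N) \<subseteq> V)"
      by blast
  next
    assume V: "V \<subseteq> carrier G \<and>
        (\<forall>h\<in>V. \<exists>N. N \<lhd> G \<and> in_class \<C> (G Mod N) \<and> (h <#\<^bsub>G\<^esub> N) \<subseteq> V)"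
    have "V = \<Union> {U. pro_basic \<C> G U \<and> U \<subseteq> V}"
      using V self unfolding pro_basic_def by blast
    then show "openin (pro_topology \<C> G) V"
      unfolding openin_pro_topology union_of_def arbitrary_def
      by (intro exI[of _ "{U. pro_basic \<C> G U \<and> U \<subseteq> V}"]) auto
  qed
  have "openin (pro_topology \<C> G) (carrier G)"
    unfolding openin using in_class_Mod_carrier[OF assms] normal_self l_coset_subset_G by blast
  then have top: "topspace (pro_topology \<C> G) = carrier G"
    using openin_subset[of "pro_topology \<C> G" "carrier G"] openin by fastforce
  show ?thesis
    unfolding closedin_def top openin using l_coset_subset_G[OF subgroup.subset[OF normal_imp_subgroup]]
    by (auto 0 4 simp: disjoint_iff subset_iff)
qed

section \<open>Finite cyclic groups in the class\<close>

lemma in_class_integer_mod_group: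
  assumes "finite_cyclic_groups \<subseteq> \<C>" "n > 0"
  shows "in_class \<C> (integer_mod_group n)"
proof -
  let ?Z = "integer_mod_group n"
  interpret Z: group ?Z by simp
  have fin: "finite (carrier ?Z)"
    using assms(2) by (simp add: carrier_integer_mod_group)
  then obtain H :: "nat monoid" where H: "group H" "H \<cong> ?Z"
    using Z.ex_nat_group_iso by blast
  \<comment> \<open>The generator is written \<open>1 mod int n\<close> because for n = 1 the number
    1 is not an element.\<close>
  have "carrier ?Z = range (\<lambda>i::int. (1 mod int n) [^]\<^bsub>?Z\<^esub> i)"
  proof (intro equalityI subsetI)
    fix x assume "x \<in> carrier ?Z"
    then have "x = (1 mod int n) [^]\<^bsub>?Z\<^esub> x"
      using assms(2) by (simp add: int_pow_integer_mod_group carrier_integer_mod_group mod_mult_right_eq)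
    then show "x \<in> range (\<lambda>i::int. (1 mod int n) [^]\<^bsub>?Z\<^esub> i)" by blast
  qed (use assms(2) in \<open>auto simp: int_pow_integer_mod_group carrier_integer_mod_group\<close>)
  moreover have "1 mod int n \<in> carrier ?Z"
    using assms(2) by (simp add: carrier_integer_mod_group)
  ultimately have "cyclic_group ?Z"
    unfolding Z.cyclic_group by blast
  then have "cyclic_group H"
    using isomorphic_group_cyclicity[OF H(2) H(1)] by simp
  moreover have "finite (carrier H)"
    using iso_finite[OF H(2)] fin by simp
  ultimately have "H \<in> \<C>"
    using assms(1) H(1) by (auto simp: finite_cyclic_groups_def)
  then show ?thesis
    using H(2) by (auto simp: in_class_def)
qed

text \<open>A finite cyclic group with generator \<open>x\<close> is a copy of the integers modulo
  the order of \<open>x\<close>.\<close>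

lemma finite_cyclic_groups_subset:
  assumes "\<And>n. n > 0 \<Longrightarrow> in_class \<C> (integer_mod_group n)"
  shows "finite_cyclic_groups \<subseteq> \<C>"
proof
  fix H :: "nat monoid" assume "H \<in> finite_cyclic_groups"
  then have H: "group H" "finite (carrier H)" "cyclic_group H"
    by (simp_all add: finite_cyclic_groups_def)
  interpret H: group H by fact
  obtain x where x: "x \<in> carrier H" "carrier H = range (\<lambda>n::int. x [^]\<^bsub>H\<^esub> n)"
    using H(3) H.cyclic_group by blast
  let ?Z = "integer_mod_group (H.ord x)"
  have n: "H.ord x > 0"
    using H.ord_ge_1[OF H(2) x(1)] by simp
  have "(\<lambda>i. x [^]\<^bsub>H\<^esub> i) ` carrier ?Z = carrier H"
  proof (intro equalityI subsetI)
    fix y assume "y \<in> carrier H"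
    then obtain i :: int where "y = x [^]\<^bsub>H\<^esub> i" using x by blast
    then have "y = x [^]\<^bsub>H\<^esub> (i mod int (H.ord x))"
      using H.int_pow_eq[OF x(1)] by (simp add: minus_mod_eq_mult_div dvd_diff_commute)
    then show "y \<in> (\<lambda>i. x [^]\<^bsub>H\<^esub> i) ` carrier ?Z"
      using n by (auto simp: carrier_integer_mod_group)
  qed (use x(1) in auto)
  then have "?Z \<cong> H"
    using H.mon_integer_mod_group_pow[OF x(1) n]
    by (intro is_isoI[of "\<lambda>i. x [^]\<^bsub>H\<^esub> i"]) (simp add: iso_iff mon_def)
  then have "in_class \<C> H"
    using in_class_iso[OF assms[OF n]] H(1) by blast
  then show "H \<in> \<C>"
    using isomorphic H(1) unfolding in_class_def by blast
qed

end

section \<open>The class of all finite groups\<close>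

lemma extension_closed_pseudovariety_finite_groups: "extension_closed_pseudovariety finite_groups"
proof (rule extension_closed_pseudovariety.intro)
  have 1: "singleton_group (0::nat) \<in> finite_groups"
    by (simp add: finite_groups_def)
  then show "finite_groups \<noteq> {}" by blast
  have in_fin: "in_class finite_groups G" if "group G" "finite (carrier G)" for G :: "'c monoid"
    using group.ex_nat_group_iso[OF that] that iso_finite unfolding in_class_def finite_groups_def
    by (metis mem_Collect_eq)
  show "in_class finite_groups (G \<times>\<times> H)" if "G \<in> finite_groups" "H \<in> finite_groups" for G H
    using that by (intro in_fin) (auto simp: finite_groups_def DirProd_group)
  show "in_class finite_groups (G Mod N)" if "G \<in> finite_groups" "N \<lhd> G" for G N
    using that by (intro in_fin) (auto simp: finite_groups_def normal.factorgroup_is_group carrier_FactGroup)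
  show "G\<lparr>carrier := K\<rparr> \<in> finite_groups" if "G \<in> finite_groups" "subgroup K G" for G K
    using that finite_subset[OF subgroup.subset] by (auto simp: finite_groups_def group.subgroup_imp_group)
  show "G \<in> finite_groups"
    if G: "group G" "N \<lhd> G" "G\<lparr>carrier := N\<rparr> \<in> finite_groups" "in_class finite_groups (G Mod N)" for G N
  proof -
    interpret N: normal N G by fact
    have "finite (carrier (G Mod N))"
      using G(4) iso_finite by (auto simp: in_class_def finite_groups_def)
    moreover have "finite N"
      using G(3) by (simp add: finite_groups_def)
    then have "finite c" if "c \<in> carrier (G Mod N)" for c
      using that by (auto simp: carrier_FactGroup r_coset_def)
    moreover have "carrier G = \<Union> (carrier (G Mod N))"
      using N.rcosets_part_G[OF N.subgroup_axioms] by (simp add: FactGroup_def)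
    ultimately show ?thesis
      using G(1) by (auto simp: finite_groups_def)
  qed
qed (auto simp: finite_groups_def iso_finite)

section \<open>Flows in Cayley graphs\<close>

text \<open>\<open>flow N w x v\<close> is the net number of times that the path from the base point labelled \<open>w\<close>
  traverses the edge labelled \<open>x\<close> that leaves the vertex \<open>v N\<close> of the Cayley graph of F/N. A
  negative letter traverses the edge that starts where the step ends.\<close>

primrec flow :: "'a letter list set \<Rightarrow> 'a letter list \<Rightarrow> 'a \<Rightarrow> 'a letter list \<Rightarrow> int" where
  "flow N [] x v = 0"
| "flow N (a # w) x v =
    (if fst a \<noteq> x then 0
     else if snd a then of_bool (v \<in> N)
     else - of_bool (push (inv_letter a) v \<in> N)) + flow N w x (push (inv_letter a) v)"

text \<open>The vertices that the path of a word visits in the Cayley tree of the free group. Modulo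
  \<open>N\<close> they bound the support of the flow, see \<open>flow_nonzero\<close>.\<close>

primrec prefixes :: "'a letter list \<Rightarrow> 'a letter list set" where
  "prefixes [] = {[]}"
| "prefixes (a # w) = insert [] (push a ` prefixes w)"

lemma finite_prefixes: "finite (prefixes w)"
  by (induction w) auto

lemma Nil_in_prefixes: "[] \<in> prefixes w"
  by (cases w) auto

text \<open>Each step changes the count at a given edge by at most 1. The bound allows a modulus so
  large that congruent flow values are equal.\<close>

lemma abs_flow_le: "\<bar>flow N w x v\<bar> \<le> int (length w)"
proof (induction w arbitrary: v)
  case (Cons a w)
  from Cons[of "push (inv_letter a) v"] show ?case by (auto simp: of_bool_def)
qed simp

lemma flow_empty: "flow {} w x v = 0"
  by (induction w arbitrary: v) auto

section \<open>The free group and the crossed homomorphism law of flows\<close>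

locale free_group_on =
  fixes X :: "'a set" and F (structure)
  assumes F: "F = free_group X"

sublocale free_group_on \<subseteq> group F
  unfolding F by (rule group_free_group)

context free_group_on
begin

lemma carrier_F: "w \<in> carrier F \<longleftrightarrow> fst ` set w \<subseteq> X \<and> reduced w"
  by (simp add: F free_group_def)

lemma mult_F: "u \<otimes> v = foldr push u v"
  by (simp add: F free_group_def)

lemma one_F: "\<one> = []"
  by (simp add: F free_group_def)

lemma Nil_closed [simp]: "[] \<in> carrier F"
  by (simp add: carrier_F)

lemma letter_closed [simp]: "[a] \<in> carrier F \<longleftrightarrow> fst a \<in> X"
  by (simp add: carrier_F)

lemma inv_cancel [simp]:
  assumes "g \<in> carrier F" "h \<in> carrier F"
  shows "g \<otimes> (inv g \<otimes> h) = h" "inv g \<otimes> (g \<otimes> h) = h"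
  using assms by (simp_all flip: m_assoc)

lemma flow_one [simp]: "flow N \<one> x v = 0"
  by (simp add: one_F)

lemma Nil_simps [simp]:
  "inv [] = []" "[] \<otimes> v = v" "v \<in> carrier F \<Longrightarrow> v \<otimes> [] = v"
  using inv_one l_one r_one[of v] by (simp_all add: one_F mult_F)

lemma push_eq: "push a v = [a] \<otimes> v"
  by (simp add: mult_F)

lemma inv_letter_eq:
  assumes "fst a \<in> X"
  shows "inv [a] = [inv_letter a]"
  using assms by (intro inv_equality) (auto simp: mult_F one_F)

lemma push_inv_letter: "fst a \<in> X \<Longrightarrow> push (inv_letter a) v = inv [a] \<otimes> v"
  by (simp add: push_eq inv_letter_eq)

lemma Cons_closedD:
  assumes "a # w \<in> carrier F"
  shows "fst a \<in> X" "w \<in> carrier F" "a # w = [a] \<otimes> w"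
proof -
  have "push a w = a # w"
    using assms by (cases w) (auto simp: carrier_F)
  then show "fst a \<in> X" "w \<in> carrier F" "a # w = [a] \<otimes> w"
    using assms by (auto simp: carrier_F mult_F dest: reduced_tl)
qed

lemma prefixes_closed: "w \<in> carrier F \<Longrightarrow> prefixes w \<subseteq> carrier F"
proof (induction w)
  case (Cons a w)
  then show ?case using Cons_closedD(1,2)[OF Cons.prems] by (auto simp: push_eq)
qed simp

text \<open>If \<open>w\<close> begins with the inverse of \<open>a\<close>, the product cancels;
  the path on the right then runs through one edge forth and back, which contributes 0.\<close>

lemma flow_push:
  assumes "fst a \<in> X" "w \<in> carrier F" "v \<in> carrier F"
  shows "flow N ([a] \<otimes> w) x v = flow N [a] x v + flow N w x (inv [a] \<otimes> v)"
proof -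
  have v: "push a (push (inv_letter a) v) = v"
    using assms(3) by (intro push_push_inv) (simp add: carrier_F)
  show ?thesis
  proof (cases "\<exists>w'. w = inv_letter a # w'")
    case True
    then obtain w' where w: "w = inv_letter a # w'" by blast
    have "[a] \<otimes> w = w'"
      by (simp add: w mult_F)
    then show ?thesis
      using v assms(1) by (cases "snd a") (auto simp: w push_inv_letter[symmetric], auto simp: inv_letter_def)
  next
    case False
    then have "[a] \<otimes> w = a # w"
      by (cases w) (auto simp: mult_F)
    then show ?thesis
      using assms(1) by (simp add: push_inv_letter)
  qed
qed

text \<open>The path of the product is the path of \<open>u\<close> followed by the translate by
  \<open>u\<close> of the path of \<open>w\<close>; cancellation between the two does not change net
  counts.\<close>

lemma flow_mult:
  assumes "u \<in> carrier F" "w \<in> carrier F" "v \<in> carrier F"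
  shows "flow N (u \<otimes> w) x v = flow N u x v + flow N w x (inv u \<otimes> v)"
  using assms
proof (induction u arbitrary: v)
  case Nil
  then show ?case by simp
next
  case (Cons a u)
  note a = Cons_closedD[OF Cons.prems(1)]
  have "flow N ((a # u) \<otimes> w) x v = flow N ([a] \<otimes> (u \<otimes> w)) x v"
    using a Cons.prems by (simp add: m_assoc)
  also have "\<dots> = flow N [a] x v + flow N (u \<otimes> w) x (inv [a] \<otimes> v)"
    using a Cons.prems by (intro flow_push) auto
  also have "\<dots> = flow N [a] x v + (flow N u x (inv [a] \<otimes> v) + flow N w x (inv u \<otimes> (inv [a] \<otimes> v)))"
    using a Cons by simp
  also have "inv u \<otimes> (inv [a] \<otimes> v) = inv (a # u) \<otimes> v"
    using a Cons.prems by (simp add: inv_mult_group m_assoc)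
  also have "flow N [a] x v + (flow N u x (inv [a] \<otimes> v) + flow N w x (inv (a # u) \<otimes> v)) =
      flow N (a # u) x v + flow N w x (inv (a # u) \<otimes> v)"
    using flow_push[of a u v] a Cons.prems by simp
  finally show ?case .
qed

text \<open>The recursion for the flow consults the subgroup only through these memberships. This
  allows flows in F/N to be compared with flows in a finite quotient.\<close>

lemma flow_cong:
  assumes "w \<in> carrier F" "v \<in> carrier F" "v' \<in> carrier F"
    and "\<And>q. q \<in> prefixes w \<Longrightarrow> inv q \<otimes> v \<in> N \<longleftrightarrow> inv q \<otimes> v' \<in> M"
  shows "flow N w x v = flow M w x v'"
  using assms
proof (induction w arbitrary: v v')
  case (Cons a w)
  note a = Cons_closedD[OF Cons.prems(1)]
  have "inv [] \<otimes> v \<in> N \<longleftrightarrow> inv [] \<otimes> v' \<in> M"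
    by (rule Cons.prems) simp
  then have 1: "v \<in> N \<longleftrightarrow> v' \<in> M"
    using Cons.prems by simp
  have IH: "inv q \<otimes> (inv [a] \<otimes> v) \<in> N \<longleftrightarrow> inv q \<otimes> (inv [a] \<otimes> v') \<in> M" if q: "q \<in> prefixes w" for q
  proof -
    have "q \<in> carrier F" using prefixes_closed[OF a(2)] q by blast
    then show ?thesis
      using Cons.prems(4)[of "[a] \<otimes> q"] a(1,2) Cons.prems(2,3) q
      by (simp add: push_eq inv_mult_group m_assoc)
  qed
  have "inv [] \<otimes> (inv [a] \<otimes> v) \<in> N \<longleftrightarrow> inv [] \<otimes> (inv [a] \<otimes> v') \<in> M"
    by (rule IH) (rule Nil_in_prefixes)
  then have "inv [a] \<otimes> v \<in> N \<longleftrightarrow> inv [a] \<otimes> v' \<in> M"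
    using Cons.prems a by simp
  moreover have "flow N w x (inv [a] \<otimes> v) = flow M w x (inv [a] \<otimes> v')"
    using Cons.prems a IH by (intro Cons.IH) auto
  ultimately show ?case
    using 1 by (simp add: push_inv_letter[OF a(1)])
qed simp

text \<open>If all these memberships failed, \<open>flow_cong\<close> would identify the flow with
  the one for the empty set, which is 0.\<close>

lemma flow_nonzero:
  assumes "w \<in> carrier F" "v \<in> carrier F" "flow N w x v \<noteq> 0"
  shows "\<exists>q\<in>prefixes w. inv q \<otimes> v \<in> N"
  using flow_cong[of w v v N "{}" x] assms by (auto simp: flow_empty)

text \<open>The flow is a function of the vertex v N of the Cayley graph, not of its
  representative.\<close>

lemma flow_shift:
  assumes "N \<lhd> F" "w \<in> carrier F" "v \<in> carrier F" "v' \<in> carrier F" "inv v \<otimes> v' \<in> N"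
  shows "flow N w x v = flow N w x v'"
proof (rule flow_cong[OF assms(2-4)])
  interpret N: normal N F by fact
  fix q assume "q \<in> prefixes w"
  then have q: "q \<in> carrier F" using prefixes_closed[OF assms(2)] by blast
  have 1: "inv q \<otimes> v' = (inv q \<otimes> v) \<otimes> (inv v \<otimes> v')"
    using q assms by (simp add: m_assoc)
  have 2: "inv q \<otimes> v = (inv q \<otimes> v') \<otimes> inv (inv v \<otimes> v')"
    using q assms by (simp add: m_assoc inv_mult_group)
  show "inv q \<otimes> v \<in> N \<longleftrightarrow> inv q \<otimes> v' \<in> N"
    using 1 2 assms(5) N.m_closed N.m_inv_closed by metis
qed

text \<open>An element \<open>u\<close> of \<open>N\<close> fixes every vertex of the Cayley graph
  of F/N, so the translation in \<open>flow_mult\<close> disappears.\<close>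

lemma flow_mult_normal:
  assumes N: "N \<lhd> F" and "u \<in> N" "w \<in> carrier F" "v \<in> carrier F"
  shows "flow N (u \<otimes> w) x v = flow N u x v + flow N w x v"
proof -
  interpret N: normal N F by fact
  have u: "u \<in> carrier F" using assms N.subset by blast
  have "inv v \<otimes> (inv u \<otimes> v) \<in> N"
    using N.inv_op_closed1[of v "inv u"] assms u by (simp add: m_assoc)
  then show ?thesis
    using assms u flow_shift[OF N, of w v "inv u \<otimes> v"] by (simp add: flow_mult)
qed

lemma flow_inv_normal:
  assumes N: "N \<lhd> F" and "u \<in> N" "v \<in> carrier F"
  shows "flow N (inv u) x v = - flow N u x v"
proof -
  interpret N: normal N F by fact
  have u: "u \<in> carrier F" using assms N.subset by blast
  have "flow N (u \<otimes> inv u) x v = flow N u x v + flow N (inv u) x v"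
    using assms u by (intro flow_mult_normal) auto
  then show ?thesis using u by simp
qed

lemma flow_pow_normal:
  assumes N: "N \<lhd> F" and "u \<in> N" "v \<in> carrier F"
  shows "flow N (u [^] (i::int)) x v = i * flow N u x v"
proof -
  interpret N: normal N F by fact
  have u: "u \<in> carrier F" using assms N.subset by blast
  have nat: "flow N (u [^] (n::nat)) x v = int n * flow N u x v \<and> u [^] n \<in> N" for n
  proof (induction n)
    case (Suc n)
    then show ?case
      using assms u by (simp add: flow_mult_normal[OF N] algebra_simps)
  qed auto
  show ?thesis
  proof (cases i rule: int_cases2)
    case (nonneg n)
    then show ?thesis using nat[of n] by (simp add: int_pow_int)
  next
    case (nonpos n)
    then show ?thesis
      using nat[of n] flow_inv_normal[OF N _ assms(3), of "u [^] n" x] u by (simp add: int_pow_neg_int)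
  qed
qed

text \<open>Conjugating a closed path by \<open>g\<close> translates it by \<open>g\<close>: the
  contributions of the connecting paths for \<open>g\<close> and its inverse cancel.\<close>

lemma flow_conj_normal:
  assumes N: "N \<lhd> F" and "u \<in> N" "g \<in> carrier F" "v \<in> carrier F"
  shows "flow N (g \<otimes> u \<otimes> inv g) x v = flow N u x (inv g \<otimes> v)"
proof -
  interpret N: normal N F by fact
  have u: "u \<in> carrier F" using assms N.subset by blast
  have "flow N (g \<otimes> u \<otimes> inv g) x v = flow N g x v + flow N (u \<otimes> inv g) x (inv g \<otimes> v)"
    using assms u by (simp add: m_assoc flow_mult)
  also have "\<dots> = flow N g x v + (flow N u x (inv g \<otimes> v) + flow N (inv g) x (inv g \<otimes> v))"
    using assms u by (simp add: flow_mult_normal)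
  also have "flow N g x v + flow N (inv g) x (inv g \<otimes> v) = flow N (g \<otimes> inv g) x v"
    using assms by (intro flow_mult[symmetric]) auto
  then have "flow N (inv g) x (inv g \<otimes> v) = - flow N g x v"
    using assms by simp
  finally show ?thesis by simp
qed

text \<open>Since 0 divides only 0, the case n = 0 is the kernel over the integers; positive n gives
  the kernel of the reduction modulo n.\<close>

definition flow_kernel :: "'a letter list set \<Rightarrow> int \<Rightarrow> 'a letter list set" where
  "flow_kernel N n = {u \<in> N. \<forall>x\<in>X. \<forall>v\<in>carrier F. n dvd flow N u x v}"

lemma normal_flow_kernel:
  assumes N: "N \<lhd> F"
  shows "flow_kernel N n \<lhd> F"
proof -
  interpret N: normal N F by fact
  have "subgroup (flow_kernel N n) F"
  proof (rule subgroup.intro)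
    show "flow_kernel N n \<subseteq> carrier F"
      using N.subset by (auto simp: flow_kernel_def)
    show "\<one> \<in> flow_kernel N n"
      using N.one_closed by (auto simp: flow_kernel_def one_F)
  next
    fix u w assume "u \<in> flow_kernel N n" "w \<in> flow_kernel N n"
    then show "u \<otimes> w \<in> flow_kernel N n"
      using N.subset by (auto simp: flow_kernel_def flow_mult_normal[OF N] subset_iff)
  next
    fix u assume "u \<in> flow_kernel N n"
    then show "inv u \<in> flow_kernel N n"
      by (auto simp: flow_kernel_def flow_inv_normal[OF N])
  qed
  moreover have "g \<otimes> u \<otimes> inv g \<in> flow_kernel N n" if "g \<in> carrier F" "u \<in> flow_kernel N n" for g u
    using that by (auto simp: flow_kernel_def flow_conj_normal[OF N] N.inv_op_closed2)
  ultimately show ?thesis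
    unfolding normal_inv_iff by blast
qed

text \<open>On \<open>N\<close> the flow is additive with values in an abelian group, so it vanishes
  on commutators.\<close>

lemma derived_subset_flow_kernel:
  assumes N: "N \<lhd> F"
  shows "derived F N \<subseteq> flow_kernel N n"
proof -
  interpret N: normal N F by fact
  have "derived_set F N \<subseteq> flow_kernel N n"
  proof
    fix w assume "w \<in> derived_set F N"
    then obtain g h where gh: "g \<in> N" "h \<in> N" and w: "w = g \<otimes> h \<otimes> inv g \<otimes> inv h"
      by blast
    have c: "g \<in> carrier F" "h \<in> carrier F" using gh N.subset by auto
    have "w = g \<otimes> (h \<otimes> (inv g \<otimes> inv h))"
      using c by (simp add: w m_assoc)
    then have "flow N w x v = 0" if "v \<in> carrier F" for x v
      using gh c that by (simp add: flow_mult_normal[OF N] flow_inv_normal[OF N])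
    then show "w \<in> flow_kernel N n"
      using gh by (auto simp: flow_kernel_def w)
  qed
  then show ?thesis
    unfolding derived_def using generate_subgroup_incl normal_imp_subgroup[OF normal_flow_kernel[OF N]] by blast
qed


text \<open>With a transversal t of N, a closed path u decomposes as the product of the elements
  t(p) a t(pa)^-1 of N over its steps a, each of which depends only on the edge that is traversed
  (with inverses for the two directions). In an abelian image of N only the net number of
  traversals of each edge therefore counts.\<close>

lemma hom_flow_kernel_zero:
  assumes N: "N \<lhd> F" and "finite X" and "comm_group A"
    and \<kappa>_hom: "\<kappa> \<in> hom (F\<lparr>carrier := N\<rparr>) A" and "u \<in> flow_kernel N 0"
  shows "\<kappa> u = \<one>\<^bsub>A\<^esub>"
proof -
  have uN: "u \<in> N" and flow0: "\<And>x v. x \<in> X \<Longrightarrow> v \<in> carrier F \<Longrightarrow> flow N u x v = 0"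
    using assms(5) by (auto simp: flow_kernel_def)
  interpret N: normal N F by fact
  interpret A: comm_group A by fact
  have u: "u \<in> carrier F" using uN N.subset by blast
  let ?N = "F\<lparr>carrier := N\<rparr>"
  interpret \<kappa>: group_hom ?N A \<kappa>
    using \<kappa>_hom by (intro group_hom.intro group_hom_axioms.intro subgroup_imp_group N.subgroup_axioms A.is_group)
  have \<kappa>_closed: "\<kappa> g \<in> carrier A" if "g \<in> N" for g
    using \<kappa>_hom that by (auto simp: hom_def)
  have \<kappa>_mult: "\<kappa> (g \<otimes> h) = \<kappa> g \<otimes>\<^bsub>A\<^esub> \<kappa> h" if "g \<in> N" "h \<in> N" for g h
    using \<kappa>.hom_mult[of g h] that by simp
  have \<kappa>_inv: "\<kappa> (inv g) = inv\<^bsub>A\<^esub> \<kappa> g" if "g \<in> N" for g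
    using \<kappa>.hom_inv[of g] that by (simp add: m_inv_consistent[OF N.subgroup_axioms])
  define t where "t v = (SOME w. w \<in> carrier F \<and> inv v \<otimes> w \<in> N)" for v
  have t: "t v \<in> carrier F" "inv v \<otimes> t v \<in> N" if "v \<in> carrier F" for v
  proof -
    have "\<exists>w. w \<in> carrier F \<and> inv v \<otimes> w \<in> N"
      using that N.one_closed by (intro exI[of _ v]) simp
    then show "t v \<in> carrier F" "inv v \<otimes> t v \<in> N"
      unfolding t_def by (metis (mono_tags, lifting) someI_ex)+
  qed
  have cong_trans: "inv a \<otimes> c \<in> N"
    if "inv a \<otimes> b \<in> N" "inv b \<otimes> c \<in> N" "a \<in> carrier F" "b \<in> carrier F" "c \<in> carrier F" for a b c
    using N.m_closed[OF that(1,2)] that(3-) by (simp add: m_assoc)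
  have cong_sym: "inv b \<otimes> a \<in> N"
    if "inv a \<otimes> b \<in> N" "a \<in> carrier F" "b \<in> carrier F" for a b
    using N.m_inv_closed[OF that(1)] that(2-) by (simp add: inv_mult_group)
  have t_eq: "t v = t w \<longleftrightarrow> inv v \<otimes> w \<in> N" if vw: "v \<in> carrier F" "w \<in> carrier F" for v w
  proof
    assume "t v = t w"
    then show "inv v \<otimes> w \<in> N"
      using t vw cong_trans[of v "t v" w] cong_sym by metis
  next
    assume *: "inv v \<otimes> w \<in> N"
    have "inv v \<otimes> y \<in> N \<longleftrightarrow> inv w \<otimes> y \<in> N" if "y \<in> carrier F" for y
      using vw that * cong_trans cong_sym by blast
    \<comment> \<open>Congruent arguments give \<open>SOME\<close> equivalent predicates, hence the
      same representative.\<close>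
    then show "t v = t w"
      unfolding t_def by (intro arg_cong[of _ _ Eps]) auto
  qed
  have tt [simp]: "t (t v) = t v" if "v \<in> carrier F" for v
    using t_eq[of v "t v"] t[OF that] that by simp
  have t_mult: "t (t v \<otimes> w) = t (v \<otimes> w)" if "v \<in> carrier F" "w \<in> carrier F" for v w
  proof -
    have "inv w \<otimes> (inv v \<otimes> t v) \<otimes> w \<in> N"
      using N.inv_op_closed1[OF that(2) t(2)[OF that(1)]] .
    then have "t (v \<otimes> w) = t (t v \<otimes> w)"
      using t[OF that(1)] that by (subst t_eq) (auto simp: inv_mult_group m_assoc)
    then show ?thesis ..
  qed
  \<comment> \<open>For a letter \<open>w\<close> this is a Schreier generator of \<open>N\<close>,
    attached to one edge. Along a word these elements telescope, which is
    \<open>s_mult\<close>.\<close>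
  define s where "s p w = t p \<otimes> w \<otimes> inv (t (p \<otimes> w))" for p w
  have s_N: "s p w \<in> N" if "p \<in> carrier F" "w \<in> carrier F" for p w
  proof -
    have "inv (t p \<otimes> w) \<otimes> t (p \<otimes> w) \<in> N"
      using t[of "t p \<otimes> w"] t[of p] that by (simp add: t_mult)
    then have "inv (inv (t p \<otimes> w) \<otimes> t (p \<otimes> w)) \<in> N"
      by (rule N.m_inv_closed)
    then have "inv (t (p \<otimes> w)) \<otimes> (t p \<otimes> w) \<in> N"
      using t[of p] t[of "p \<otimes> w"] that by (simp add: inv_mult_group m_assoc)
    then have "t (p \<otimes> w) \<otimes> (inv (t (p \<otimes> w)) \<otimes> (t p \<otimes> w)) \<otimes> inv (t (p \<otimes> w)) \<in> N"
      using t[of "p \<otimes> w"] that by (intro N.inv_op_closed2) auto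
    then show ?thesis
      using t[of p] t[of "p \<otimes> w"] that by (simp add: s_def)
  qed
  have s_mult: "s p (g \<otimes> w) = s p g \<otimes> s (p \<otimes> g) w"
    if "p \<in> carrier F" "g \<in> carrier F" "w \<in> carrier F" for p g w
    using that t by (simp add: s_def m_assoc)
  define c where "c = (\<lambda>(v, x). \<kappa> (s v [(x, True)]))"
  have c_closed: "c e \<in> carrier A" if "e \<in> carrier F \<times> X" for e
    using that s_N \<kappa>_closed by (auto simp: c_def)
  \<comment> \<open>The finite set \<open>T\<close> of representatives contains both ends of the
    step, so it contains the start of the edge, and every other factor of the product is
    trivial.\<close>
  have single: "\<kappa> (s p [a]) =
      finprod A (\<lambda>(v, x). c (v, x) [^]\<^bsub>A\<^esub> flow N [a] x (inv p \<otimes> v)) (T \<times> X)"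
    if p: "p \<in> carrier F" and a: "fst a \<in> X"
      and T: "finite T" "T \<subseteq> carrier F" "\<And>v. v \<in> T \<Longrightarrow> t v = v" "t p \<in> T" "t (p \<otimes> [a]) \<in> T"
    for p a T
  proof -
    obtain y b where ab: "a = (y, b)" by force
    have y: "y \<in> X" using a ab by simp
    \<comment> \<open>The start of the traversed edge in its positive direction; a negative letter
      arrives there.\<close>
    define q where "q = (if b then p else p \<otimes> [a])"
    have q: "q \<in> carrier F" "t q \<in> T"
      using p a T by (auto simp: q_def)
    define f where "f = (\<lambda>e. c e [^]\<^bsub>A\<^esub> (if b then 1 else - 1 :: int))"
    have eq: "c (v, x) [^]\<^bsub>A\<^esub> flow N [a] x (inv p \<otimes> v) =
        (if (t q, y) = (v, x) then f (v, x) else \<one>\<^bsub>A\<^esub>)" if "v \<in> T" "x \<in> X" for v x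
    proof -
      have v: "v \<in> carrier F" using that T by blast
      have "v = t q \<longleftrightarrow> inv q \<otimes> v \<in> N"
        using t_eq[of q v] q v T(3)[OF that(1)] by auto
      moreover have "inv q \<otimes> v = (if b then inv p \<otimes> v else push (inv_letter a) (inv p \<otimes> v))"
        using p a v by (simp add: q_def push_inv_letter inv_mult_group m_assoc)
      ultimately show ?thesis
        by (auto simp: f_def ab of_bool_def)
    qed
    have "finprod A (\<lambda>(v, x). c (v, x) [^]\<^bsub>A\<^esub> flow N [a] x (inv p \<otimes> v)) (T \<times> X)
        = finprod A (\<lambda>e. if (t q, y) = e then f e else \<one>\<^bsub>A\<^esub>) (T \<times> X)"
    proof (rule A.finprod_cong'[OF refl])
      show "(\<lambda>e. if (t q, y) = e then f e else \<one>\<^bsub>A\<^esub>) \<in> T \<times> X \<rightarrow> carrier A"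
        using T(2) c_closed by (auto simp: f_def)
    next
      fix e assume "e \<in> T \<times> X"
      then obtain v x where "e = (v, x)" "v \<in> T" "x \<in> X" by blast
      then show "(case e of (v, x) \<Rightarrow> c (v, x) [^]\<^bsub>A\<^esub> flow N [a] x (inv p \<otimes> v)) =
          (if (t q, y) = e then f e else \<one>\<^bsub>A\<^esub>)"
        by (simp only: eq prod.case)
    qed
    also have "\<dots> = f (t q, y)"
      using T(1,2) c_closed q y \<open>finite X\<close> by (intro A.finprod_singleton) (auto simp: f_def)
    also have "\<dots> = \<kappa> (s p [a])"
    proof (cases b)
      case True
      then have "c (t q, y) = \<kappa> (s p [a])"
        using p a t by (simp add: c_def s_def ab q_def t_mult)
      then show ?thesis
        using True p a s_N \<kappa>_closed by (simp add: f_def)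
    next
      case False
      have ia: "[(y, True)] = inv [a]"
        using a by (simp add: inv_letter_eq inv_letter_def ab False)
      have "s q [(y, True)] = inv (s p [a])"
        using p a t False by (simp add: s_def ia q_def inv_mult_group m_assoc)
      moreover have "s (t q) [(y, True)] = s q [(y, True)]"
        using q y t by (simp add: s_def t_mult)
      ultimately have "c (t q, y) = inv\<^bsub>A\<^esub> \<kappa> (s p [a])"
        using p a s_N \<kappa>_inv by (simp add: c_def)
      then show ?thesis
        using False p a s_N \<kappa>_closed by (simp add: f_def A.int_pow_neg)
    qed
    finally show ?thesis ..
  qed
  \<comment> \<open>\<open>T\<close> stays fixed while \<open>p\<close> varies, so the products for
    the first letter and for the rest have the same index set and are multiplied factor by
    factor.\<close>
  have path: "\<kappa> (s p w) =
      finprod A (\<lambda>(v, x). c (v, x) [^]\<^bsub>A\<^esub> flow N w x (inv p \<otimes> v)) (T \<times> X)"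
    if "p \<in> carrier F" "w \<in> carrier F" and T: "finite T" "T \<subseteq> carrier F" "\<And>v. v \<in> T \<Longrightarrow> t v = v"
      and "\<And>q. q \<in> prefixes w \<Longrightarrow> t (p \<otimes> q) \<in> T" for p w T
    using that(1,2,6)
  proof (induction w arbitrary: p)
    case Nil
    have "s p [] = \<one>"
      using Nil t by (simp add: s_def)
    moreover have "\<kappa> \<one> = \<one>\<^bsub>A\<^esub>"
      using \<kappa>.hom_one by simp
    moreover have "finprod A (\<lambda>(v, x). c (v, x) [^]\<^bsub>A\<^esub> flow N [] x (inv p \<otimes> v)) (T \<times> X) = \<one>\<^bsub>A\<^esub>"
      by (intro A.finprod_one_eqI) auto
    ultimately show ?case by simp
  next
    case (Cons a w)
    note a = Cons_closedD[OF Cons.prems(2)]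
    let ?f = "\<lambda>(v, x). c (v, x) [^]\<^bsub>A\<^esub> flow N [a] x (inv p \<otimes> v)"
    let ?g = "\<lambda>(v, x). c (v, x) [^]\<^bsub>A\<^esub> flow N w x (inv (p \<otimes> [a]) \<otimes> v)"
    have ca: "[a] \<in> carrier F" using a by simp
    have pref: "t (p \<otimes> [a] \<otimes> q) \<in> T" if "q \<in> prefixes w" for q
    proof -
      have "q \<in> carrier F" using prefixes_closed[OF a(2)] that by blast
      then show ?thesis
        using Cons.prems(3)[of "push a q"] that Cons.prems(1) ca by (simp add: push_eq m_assoc)
    qed
    have "t p \<in> T"
      using Cons.prems(3)[of "[]"] Cons.prems(1) by simp
    moreover have "t (p \<otimes> [a]) \<in> T"
      using pref[OF Nil_in_prefixes] Cons.prems(1) ca by simp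
    ultimately have 1: "\<kappa> (s p [a]) = finprod A ?f (T \<times> X)"
      by (intro single) (use a T Cons.prems(1) in auto)
    have 2: "\<kappa> (s (p \<otimes> [a]) w) = finprod A ?g (T \<times> X)"
      using Cons.prems(1) a pref by (intro Cons.IH) auto
    have fg: "?f \<in> T \<times> X \<rightarrow> carrier A" "?g \<in> T \<times> X \<rightarrow> carrier A"
      using c_closed T by auto
    have "\<kappa> (s p (a # w)) = \<kappa> (s p [a] \<otimes> s (p \<otimes> [a]) w)"
      using s_mult[OF Cons.prems(1) ca a(2)] a(3) by simp
    also have "\<dots> = \<kappa> (s p [a]) \<otimes>\<^bsub>A\<^esub> \<kappa> (s (p \<otimes> [a]) w)"
      using s_N Cons.prems(1) ca a by (intro \<kappa>_mult) auto
    also have "\<dots> = finprod A (\<lambda>e. ?f e \<otimes>\<^bsub>A\<^esub> ?g e) (T \<times> X)"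
      unfolding 1 2 using fg by (rule A.finprod_multf[symmetric])
    also have "\<dots> = finprod A (\<lambda>(v, x). c (v, x) [^]\<^bsub>A\<^esub> flow N (a # w) x (inv p \<otimes> v)) (T \<times> X)"
    proof (rule A.finprod_cong'[OF refl])
      show "(\<lambda>(v, x). c (v, x) [^]\<^bsub>A\<^esub> flow N (a # w) x (inv p \<otimes> v)) \<in> T \<times> X \<rightarrow> carrier A"
        using c_closed T by auto
    next
      fix e assume "e \<in> T \<times> X"
      then obtain v x where e: "e = (v, x)" "v \<in> carrier F" "x \<in> X" using T by blast
      have "flow N (a # w) x (inv p \<otimes> v) =
          flow N [a] x (inv p \<otimes> v) + flow N w x (inv (p \<otimes> [a]) \<otimes> v)"
        using flow_push[of a w "inv p \<otimes> v" N x] a ca e Cons.prems(1)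
        by (simp add: inv_mult_group m_assoc)
      then show "?f e \<otimes>\<^bsub>A\<^esub> ?g e = (case e of (v, x) \<Rightarrow> c (v, x) [^]\<^bsub>A\<^esub> flow N (a # w) x (inv p \<otimes> v))"
        using c_closed e by (simp add: A.int_pow_mult)
    qed
    finally show ?case .
  qed
  have "\<kappa> (s \<one> u) = finprod A (\<lambda>(v, x). c (v, x) [^]\<^bsub>A\<^esub> flow N u x (inv \<one> \<otimes> v)) (t ` prefixes u \<times> X)"
    using u t prefixes_closed[OF u] by (intro path) (auto simp: subset_iff finite_prefixes)
  also have "\<dots> = \<one>\<^bsub>A\<^esub>"
    using flow0 t prefixes_closed[OF u] by (intro A.finprod_one_eqI) (auto simp: subset_iff)
  finally have "\<kappa> (s \<one> u) = \<one>\<^bsub>A\<^esub>" .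
  \<comment> \<open>The path of \<open>u\<close> is closed modulo \<open>N\<close>, so
    \<open>s\<close> yields a conjugate of \<open>u\<close> by an element of \<open>N\<close>, which
    the abelian group \<open>A\<close> cannot tell from \<open>u\<close>.\<close>
  moreover have "t u = t \<one>"
    using t_eq[of \<one> u] u uN by simp
  then have "s \<one> u = t \<one> \<otimes> u \<otimes> inv (t \<one>)"
    using u by (simp add: s_def)
  moreover have "t \<one> \<in> N"
    using t[OF one_closed] by simp
  then have "\<kappa> (t \<one> \<otimes> u \<otimes> inv (t \<one>)) = \<kappa> u"
    using uN \<kappa>_closed
    by (simp add: \<kappa>_mult \<kappa>_inv A.m_comm[of "\<kappa> (t \<one>)"] A.m_assoc)
  ultimately show ?thesis by simp
qed

text \<open>\<open>hom_flow_kernel_zero\<close> is applied to the projection of \<open>N\<close>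
  onto its abelianization, whose kernel is the derived subgroup.\<close>

lemma flow_kernel_zero_subset_derived:
  assumes N: "N \<lhd> F" and "finite X"
  shows "flow_kernel N 0 \<subseteq> derived F N"
proof
  fix u assume u: "u \<in> flow_kernel N 0"
  interpret N: normal N F by fact
  let ?N = "F\<lparr>carrier := N\<rparr>" and ?D = "derived F N"
  interpret D: normal ?D F by (rule derived_is_normal[OF N])
  interpret DN: normal ?D ?N by (rule derived_subgroup_is_normal[OF N.subgroup_axioms])
  have "(\<lambda>u. ?D #>\<^bsub>?N\<^esub> u) \<in> hom ?N (?N Mod ?D)"
    by (rule DN.r_coset_hom_Mod)
  from hom_flow_kernel_zero[OF N \<open>finite X\<close>
      derived_quot_of_subgroup_is_comm_group[OF N.subgroup_axioms] this u]
  have "?D #> u = ?D" by simp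
  moreover have "u \<in> carrier F"
    using u N.subset by (auto simp: flow_kernel_def)
  ultimately show "u \<in> ?D"
    using coset_join1[OF _ _ D.subgroup_axioms] by blast
qed

lemma derived_eq_flow_kernel:
  assumes "N \<lhd> F" "finite X"
  shows "derived F N = flow_kernel N 0"
  using derived_subset_flow_kernel flow_kernel_zero_subset_derived assms by blast

section \<open>Torsion-freeness of the quotients by iterated derived subgroups\<close>

definition torsion_free_mod :: "'a letter list set \<Rightarrow> bool" where
  "torsion_free_mod N \<longleftrightarrow> (\<forall>g\<in>carrier F. \<forall>i::int. i \<noteq> 0 \<longrightarrow> g [^] i \<in> N \<longrightarrow> g \<in> N)"

text \<open>If a nonzero power g^i lies in N', then g lies in \<open>N\<close> because F/N is
  torsion-free. There the flow of g^i is i times that of g, and the integers have no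
  torsion.\<close>

lemma torsion_free_mod_derived:
  assumes N: "N \<lhd> F" and "finite X" and "torsion_free_mod N"
  shows "torsion_free_mod (derived F N)"
proof -
  have "g \<in> flow_kernel N 0" if g: "g \<in> carrier F" "i \<noteq> 0" "g [^] i \<in> flow_kernel N 0" for g and i :: int
  proof -
    have "g [^] i \<in> N" using g(3) by (simp add: flow_kernel_def)
    then have "g \<in> N" using assms(3) g unfolding torsion_free_mod_def by blast
    then show ?thesis
      using g by (auto simp: flow_kernel_def flow_pow_normal[OF N])
  qed
  then show ?thesis
    unfolding torsion_free_mod_def derived_eq_flow_kernel[OF N \<open>finite X\<close>] by blast
qed

lemma exp_of_derived_normal_torsion_free:
  assumes "finite X"
  shows "(derived F ^^ k) (carrier F) \<lhd> F \<and> torsion_free_mod ((derived F ^^ k) (carrier F))"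
proof (induction k)
  case 0
  show ?case by (simp add: torsion_free_mod_def normal_self)
next
  case (Suc k)
  then show ?case
    using assms derived_is_normal torsion_free_mod_derived by simp
qed

end

section \<open>Separating cyclic subgroups modulo the derived subgroup\<close>

text \<open>If \<open>b\<close> vanishes on \<open>I\<close>, or some nonzero \<open>b e\<close>
  does not divide \<open>a e\<close>, one coordinate suffices. Otherwise coordinate \<open>e\<close>
  vanishes at a single integer \<open>j\<close>, and some coordinate \<open>d\<close> is nonzero
  there; the modulus combines both.\<close>

lemma ex_modulus_avoiding_line:
  fixes a b :: "'e \<Rightarrow> int"
  assumes "\<And>i. \<exists>e\<in>I. a e + i * b e \<noteq> 0"
  obtains n :: nat where "n > 0" "\<And>i. \<exists>e\<in>I. \<not> int n dvd a e + i * b e"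
proof -
  consider (zero) "\<forall>e\<in>I. b e = 0" | (nondvd) e where "e \<in> I" "b e \<noteq> 0" "\<not> b e dvd a e"
    | (dvd) e where "e \<in> I" "b e \<noteq> 0" "b e dvd a e"
    by blast
  then show thesis
  proof cases
    case zero
    obtain e where e: "e \<in> I" "a e \<noteq> 0" using assms[of 0] by auto
    have "\<not> (\<bar>a e\<bar> + 1) dvd a e"
      using e(2) dvd_imp_le_int[of "a e" "\<bar>a e\<bar> + 1"] by auto
    then show thesis
      using that[of "nat (\<bar>a e\<bar> + 1)"] zero e(1) by force
  next
    case nondvd
    have "\<not> \<bar>b e\<bar> dvd a e + i * b e" for i
      using nondvd by (simp add: dvd_add_left_iff)
    then show thesis
      using that[of "nat \<bar>b e\<bar>"] nondvd(1,2)
      by (metis int_nat_eq abs_ge_zero zero_less_abs_iff zero_less_nat_eq)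
  next
    case dvd
    define j where "j = - (a e div b e)"
    have j: "a e = - j * b e" using dvd by (simp add: j_def)
    obtain d where d: "d \<in> I" "a d + j * b d \<noteq> 0" using assms by blast
    define c where "c = a d + j * b d"
    define m where "m = \<bar>c\<bar> + 1"
    have m: "\<not> m dvd c" "m > 0"
      using d(2) dvd_imp_le_int[of c m] by (auto simp: m_def c_def)
    \<comment> \<open>Divisibility at \<open>e\<close> makes \<open>i\<close> congruent to
      \<open>j\<close> modulo \<open>m\<close>; then the entry at \<open>d\<close> is congruent to
      \<open>c\<close>, which \<open>m\<close> does not divide.\<close>
    have "\<not> \<bar>b e\<bar> * m dvd a e + i * b e \<or> \<not> \<bar>b e\<bar> * m dvd a d + i * b d" for i
    proof (rule ccontr)
      assume *: "\<not> ?thesis"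
      have "\<bar>b e\<bar> * m dvd (i - j) * b e"
        using * j by (simp add: algebra_simps)
      moreover have "b e * m dvd \<bar>b e\<bar> * m"
        by (intro mult_dvd_mono) auto
      ultimately have "b e * m dvd b e * (i - j)"
        unfolding mult.commute[of "i - j"] by (rule dvd_trans[rotated])
      then have "m dvd i - j" using dvd(2) by simp
      moreover have "m dvd a d + i * b d"
        using * dvd_mult_right[of "\<bar>b e\<bar>" m] by blast
      moreover have "c = a d + i * b d - (i - j) * b d"
        by (simp add: c_def algebra_simps)
      ultimately show False using m(1) by (metis dvd_diff dvd_mult2)
    qed
    moreover have "\<bar>b e\<bar> * m > 0" using dvd(2) m(2) by simp
    ultimately show thesis
      using that[of "nat (\<bar>b e\<bar> * m)"] dvd(1) d(1) by (metis int_nat_eq less_imp_le zero_less_nat_eq)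
  qed
qed

section \<open>Quotients in the class obtained from flows modulo n\<close>

locale free_group_pseudovariety = free_group_on X F + C: extension_closed_pseudovariety \<C>
  for X :: "'a set" and F (structure) and \<C> +
  assumes finite_X: "finite X" and cyclic: "finite_cyclic_groups \<subseteq> \<C>"
begin

text \<open>A flow is determined by its values on finitely many edges, indexed by \<open>X\<close>
  and representatives \<open>V\<close> of F/N. Each edge gives a homomorphism from \<open>N\<close>
  to the integers modulo \<open>n\<close>; the common kernel has its quotient in the class, and F/N
  is extended by that quotient.\<close>

lemma in_class_Mod_flow_kernel:
  assumes N: "N \<lhd> F" and "in_class \<C> (F Mod N)" "n > 0"
  shows "in_class \<C> (F Mod flow_kernel N (int n))"
proof -
  interpret N: normal N F by fact
  let ?N = "F\<lparr>carrier := N\<rparr>"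
  have gN: "group ?N" by (rule subgroup_imp_group[OF N.subgroup_axioms])
  have "finite (carrier (F Mod N))" by (rule C.in_class_finite) fact
  then obtain V where V: "V \<subseteq> carrier F" "finite V" "(\<lambda>v. N #> v) ` carrier F = (\<lambda>v. N #> v) ` V"
    using finite_subset_image[of "carrier (F Mod N)" "\<lambda>v. N #> v" "carrier F"]
    unfolding carrier_FactGroup by blast
  have rep: "\<exists>w\<in>V. inv w \<otimes> v \<in> N" if v: "v \<in> carrier F" for v
  proof -
    obtain w where w: "w \<in> V" "N #> v = N #> w" using V(3) v by blast
    then have "v \<in> N #> w" using rcos_self[OF v N.subgroup_axioms] by simp
    then obtain m where m: "m \<in> N" "v = m \<otimes> w" unfolding r_coset_def by blast
    then have "inv w \<otimes> v = inv w \<otimes> m \<otimes> w" using V(1) w(1) N.subset by (auto simp: m_assoc subset_iff)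
    then show ?thesis using N.inv_op_closed1[of w m] m(1) w(1) V(1) by (metis subsetD)
  qed
  define K where "K = (\<lambda>(x, v). {u \<in> N. int n dvd flow N u x v})"
  have K: "K e \<lhd> ?N \<and> in_class \<C> (?N Mod K e)" if e: "e \<in> X \<times> V" for e
  proof -
    obtain x v where xv: "e = (x, v)" "v \<in> carrier F" using e V(1) by blast
    let ?f = "\<lambda>u. flow N u x v mod int n"
    have "?f \<in> hom ?N (integer_mod_group n)"
      using xv N.subset assms(3) by (auto simp: hom_def flow_mult_normal[OF N] carrier_integer_mod_group mod_simps subset_iff)
    then have f: "group_hom ?N (integer_mod_group n) ?f"
      using gN by (simp add: group_hom_def group_hom_axioms_def)
    have "kernel ?N (integer_mod_group n) ?f = K e"
      by (auto simp: kernel_def K_def xv)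
    then show ?thesis
      using group_hom.normal_kernel[OF f] C.in_class_Mod_kernel[OF f C.in_class_integer_mod_group[OF cyclic assms(3)]]
      by simp
  qed
  have "flow_kernel N (int n) = N \<inter> (\<Inter>e\<in>X \<times> V. K e)"
  proof (intro equalityI subsetI)
    fix u assume "u \<in> flow_kernel N (int n)"
    then show "u \<in> N \<inter> (\<Inter>e\<in>X \<times> V. K e)"
      using V(1) by (auto simp: flow_kernel_def K_def)
  next
    fix u assume u: "u \<in> N \<inter> (\<Inter>e\<in>X \<times> V. K e)"
    have "int n dvd flow N u x v" if xv: "x \<in> X" "v \<in> carrier F" for x v
    proof -
      obtain w where w: "w \<in> V" "inv w \<otimes> v \<in> N" using rep[OF xv(2)] by blast
      have "flow N u x w = flow N u x v"
        using u w V(1) xv N.subset by (intro flow_shift[OF N]) auto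
      moreover have "u \<in> K (x, w)" using u w(1) xv(1) by blast
      ultimately show ?thesis by (simp add: K_def)
    qed
    then show "u \<in> flow_kernel N (int n)"
      using u by (auto simp: flow_kernel_def)
  qed
  moreover have "in_class \<C> (?N Mod (carrier ?N \<inter> (\<Inter>e\<in>X \<times> V. K e)))"
    using C.in_class_Mod_INT[of "X \<times> V" ?N K] K finite_X V(2) gN by blast
  ultimately have "in_class \<C> (?N Mod flow_kernel N (int n))"
    by simp
  moreover have "flow_kernel N (int n) \<subseteq> N"
    by (auto simp: flow_kernel_def)
  ultimately show ?thesis
    using C.in_class_Mod_extension[OF normal_flow_kernel[OF N] N _ assms(2)] by blast
qed

text \<open>Closedness of the cyclic subgroups of F/N, phrased inside F: as \<open>i\<close> runs
  through all integers, no g^i h lies in \<open>N\<close> exactly when the coset of \<open>h\<close>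
  is not a power of the coset of \<open>g\<close>.\<close>

definition cyclic_separable_mod :: "'a letter list set \<Rightarrow> bool" where
  "cyclic_separable_mod N \<longleftrightarrow> (\<forall>g\<in>carrier F. \<forall>h\<in>carrier F. (\<forall>i::int. g [^] i \<otimes> h \<notin> N) \<longrightarrow>
    (\<exists>M. M \<lhd> F \<and> N \<subseteq> M \<and> in_class \<C> (F Mod M) \<and> (\<forall>i::int. g [^] i \<otimes> h \<notin> M)))"

text \<open>The case g = 1 of separability excludes one element of \<open>S\<close>; finitely many
  such subgroups are intersected.\<close>

lemma separate_finite:
  assumes "N \<lhd> F" "cyclic_separable_mod N" "finite S" "S \<subseteq> carrier F" "S \<inter> N = {}"
  obtains M where "M \<lhd> F" "N \<subseteq> M" "in_class \<C> (F Mod M)" "S \<inter> M = {}"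
proof -
  interpret N: normal N F by fact
  have "\<exists>M. M \<lhd> F \<and> N \<subseteq> M \<and> in_class \<C> (F Mod M) \<and> h \<notin> M" if h: "h \<in> S" for h
  proof -
    have hF: "h \<in> carrier F" and "h \<notin> N"
      using h assms(4,5) by auto
    then have "\<forall>i::int. \<one> [^] i \<otimes> h \<notin> N"
      by simp
    then obtain M where "M \<lhd> F" "N \<subseteq> M" "in_class \<C> (F Mod M)" "\<forall>i::int. \<one> [^] i \<otimes> h \<notin> M"
      using assms(2) one_closed hF unfolding cyclic_separable_mod_def by blast
    then show ?thesis
      using hF by auto
  qed
  then obtain M where M: "\<And>h. h \<in> S \<Longrightarrow> M h \<lhd> F \<and> N \<subseteq> M h \<and> in_class \<C> (F Mod M h) \<and> h \<notin> M h"
    by metis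
  show thesis
  proof
    show "carrier F \<inter> (\<Inter>h\<in>S. M h) \<lhd> F" "in_class \<C> (F Mod (carrier F \<inter> (\<Inter>h\<in>S. M h)))"
      using C.in_class_Mod_INT[of S F M] assms(3) M is_group by blast+
    show "N \<subseteq> carrier F \<inter> (\<Inter>h\<in>S. M h)"
      using M N.subset by blast
    show "S \<inter> (carrier F \<inter> (\<Inter>h\<in>S. M h)) = {}"
      using M by blast
  qed
qed

text \<open>The quotients p^-1 q outside \<open>N\<close>, for p and q in \<open>W\<close>, are
  excluded from \<open>M\<close> as well. Distinct vertices represented in \<open>W\<close> thus
  stay distinct modulo \<open>M\<close>, and \<open>flow_cong\<close> applies.\<close>

lemma separate_prefixes:
  assumes N: "N \<lhd> F" "cyclic_separable_mod N" and W: "finite W" "W \<subseteq> carrier F"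
    and S: "finite S" "S \<subseteq> carrier F" "S \<inter> N = {}"
  obtains M where "M \<lhd> F" "N \<subseteq> M" "in_class \<C> (F Mod M)" "S \<inter> M = {}"
    "\<And>w x q. w \<in> carrier F \<Longrightarrow> prefixes w \<subseteq> W \<Longrightarrow> q \<in> W \<Longrightarrow> flow M w x q = flow N w x q"
proof -
  let ?D = "(\<lambda>(p, q). inv p \<otimes> q) ` (W \<times> W) - N"
  obtain M where M: "M \<lhd> F" "N \<subseteq> M" "in_class \<C> (F Mod M)" "(S \<union> ?D) \<inter> M = {}"
  proof (rule separate_finite[OF N])
    show "finite (S \<union> ?D)" using W S by simp
    show "S \<union> ?D \<subseteq> carrier F" using W S by auto
    show "(S \<union> ?D) \<inter> N = {}" using S by auto
  qed
  have D: "inv p \<otimes> q \<in> M \<longleftrightarrow> inv p \<otimes> q \<in> N" if "p \<in> W" "q \<in> W" for p q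
    using that M(2,4) by auto
  show thesis
  proof
    fix w x q assume "w \<in> carrier F" "prefixes w \<subseteq> W" "q \<in> W"
    then show "flow M w x q = flow N w x q"
      using W(2) D by (intro flow_cong) auto
  qed (use M in auto)
qed

text \<open>For \<open>g\<close> and \<open>u\<close> in \<open>N\<close> the flow of g^i u is the
  flow of \<open>u\<close> plus i times that of \<open>g\<close>, so the task is to keep a line of
  integer vectors away from 0 modulo n.\<close>

lemma separate_normal:
  assumes N: "N \<lhd> F" "cyclic_separable_mod N" and gu: "g \<in> N" "u \<in> N"
    and *: "\<And>i::int. g [^] i \<otimes> u \<notin> flow_kernel N 0"
  obtains M n where "M \<lhd> F" "N \<subseteq> M" "in_class \<C> (F Mod M)" "n > 0"
    "\<And>i::int. g [^] i \<otimes> u \<notin> flow_kernel M (int n)"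
proof -
  interpret N: normal N F by fact
  define W where "W = prefixes g \<union> prefixes u"
  have gF: "g \<in> carrier F" and uF: "u \<in> carrier F" using gu N.subset by auto
  have W: "finite W" "W \<subseteq> carrier F"
    using prefixes_closed[OF gF] prefixes_closed[OF uF] by (auto simp: W_def finite_prefixes)
  have pow: "g [^] i \<in> P" if "N \<subseteq> P" "P \<lhd> F" for i :: int and P
    using that gu subgroup_int_pow_closed[OF normal_imp_subgroup] by blast
  have lin: "flow P (g [^] i \<otimes> u) x v = flow P u x v + i * flow P g x v"
    if "N \<subseteq> P" "P \<lhd> F" "v \<in> carrier F" for i P x v
    using that gu pow[OF that(1,2)] uF
    by (simp add: flow_mult_normal[OF that(2)] flow_pow_normal[OF that(2)] subset_iff)
  obtain M where M: "M \<lhd> F" "N \<subseteq> M" "in_class \<C> (F Mod M)"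
    "\<And>w x q. w \<in> carrier F \<Longrightarrow> prefixes w \<subseteq> W \<Longrightarrow> q \<in> W \<Longrightarrow> flow M w x q = flow N w x q"
    by (rule separate_prefixes[OF N W, of "{}"]) auto
  have "\<exists>e\<in>X \<times> W. flow N u (fst e) (snd e) + i * flow N g (fst e) (snd e) \<noteq> 0" for i
  proof -
    have "g [^] i \<otimes> u \<in> N" using pow[OF subset_refl N(1)] gu by blast
    then obtain x v where xv: "x \<in> X" "v \<in> carrier F" "flow N (g [^] i \<otimes> u) x v \<noteq> 0"
      using *[of i] by (auto simp: flow_kernel_def)
    then have nz: "flow N u x v + i * flow N g x v \<noteq> 0"
      using lin[OF subset_refl N(1)] by simp
    then have "flow N u x v \<noteq> 0 \<or> flow N g x v \<noteq> 0" by auto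
    \<comment> \<open>A vertex where one of the two flows is nonzero is congruent to a prefix, so
      the finite set \<open>W\<close> already detects that the line misses 0.\<close>
    then obtain q where q: "q \<in> W" "inv q \<otimes> v \<in> N"
      using flow_nonzero[OF uF xv(2)] flow_nonzero[OF gF xv(2)] unfolding W_def by blast
    have "flow N u x q = flow N u x v" "flow N g x q = flow N g x v"
      using q W(2) xv uF gF by (auto intro!: flow_shift[OF N(1)])
    then show ?thesis using nz q(1) xv(1) by (intro bexI[of _ "(x, q)"]) auto
  qed
  then obtain n :: nat where n: "n > 0"
    "\<And>i. \<exists>e\<in>X \<times> W. \<not> int n dvd flow N u (fst e) (snd e) + i * flow N g (fst e) (snd e)"
    by (rule ex_modulus_avoiding_line) blast
  show thesis
  proof (rule that[OF M(1-3) n(1)])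
    fix i :: int
    obtain x q where q: "x \<in> X" "q \<in> W" "\<not> int n dvd flow N u x q + i * flow N g x q"
      using n(2)[of i] by auto
    have "flow M (g [^] i \<otimes> u) x q = flow N u x q + i * flow N g x q"
      using lin[OF M(2,1), of q i x] M(4)[OF uF, of q x] M(4)[OF gF, of q x] q(2) W(2)
      by (auto simp: W_def)
    then have "\<not> int n dvd flow M (g [^] i \<otimes> u) x q"
      using q(3) by simp
    then show "g [^] i \<otimes> u \<notin> flow_kernel M (int n)"
      using q(1,2) W(2) unfolding flow_kernel_def by blast
  qed
qed

text \<open>If some power of g agreed with u modulo the flow kernel of M, then the flow of u would be
  invariant under g, so its support, which lies in the prefixes of u, would contain an orbit of g
  that is too long.\<close>

lemma separate_non_normal:
  assumes N: "N \<lhd> F" "cyclic_separable_mod N" and "torsion_free_mod N"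
    and g: "g \<in> carrier F" "g \<notin> N" and u: "u \<in> N" "u \<notin> flow_kernel N 0"
  obtains M n where "M \<lhd> F" "N \<subseteq> M" "in_class \<C> (F Mod M)" "n > 0"
    "\<And>i::int. g [^] i \<otimes> u \<notin> flow_kernel M (int n)"
proof -
  interpret N: normal N F by fact
  define W where "W = prefixes u"
  have uF: "u \<in> carrier F" using u N.subset by auto
  have W: "finite W" "W \<subseteq> carrier F"
    using prefixes_closed[OF uF] by (auto simp: W_def finite_prefixes)
  \<comment> \<open>These powers avoid \<open>N\<close> by torsion-freeness; keeping them out of
    \<open>M\<close> makes the cosets of g^0, ..., g^card W modulo \<open>M\<close>
    distinct.\<close>
  define S where "S = (\<lambda>j. g [^] int j) ` {1..card W}"
  have S: "finite S" "S \<subseteq> carrier F" "S \<inter> N = {}"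
    using g assms(3) unfolding torsion_free_mod_def S_def by auto
  obtain M where M: "M \<lhd> F" "N \<subseteq> M" "in_class \<C> (F Mod M)" "S \<inter> M = {}"
    "\<And>w x q. w \<in> carrier F \<Longrightarrow> prefixes w \<subseteq> W \<Longrightarrow> q \<in> W \<Longrightarrow> flow M w x q = flow N w x q"
    by (rule separate_prefixes[OF N W S]) blast
  interpret M: normal M F by fact
  have uM: "u \<in> M" using u(1) M(2) by blast
  obtain x v where xv: "x \<in> X" "v \<in> carrier F" "flow N u x v \<noteq> 0"
    using u by (auto simp: flow_kernel_def)
  then obtain p where p: "p \<in> W" "inv p \<otimes> v \<in> N"
    using flow_nonzero[OF uF xv(2,3)] unfolding W_def by blast
  have pF: "p \<in> carrier F" using p W by blast
  have "flow N u x p = flow N u x v"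
    using p pF xv uF by (intro flow_shift[OF N(1)]) auto
  then have p0: "flow M u x p \<noteq> 0"
    using M(5)[OF uF _ p(1)] xv(3) by (simp add: W_def)
  \<comment> \<open>Two values of the flow of \<open>u\<close> differ by at most twice its length,
    so values congruent modulo \<open>n\<close> are equal.\<close>
  define n where "n = 2 * length u + 1"
  show thesis
  proof (rule that[OF M(1-3), of n])
    fix i :: int
    show "g [^] i \<otimes> u \<notin> flow_kernel M (int n)"
    proof
      assume K: "g [^] i \<otimes> u \<in> flow_kernel M (int n)"
      have gi: "g [^] i \<in> carrier F" using g by simp
      have "g [^] i \<otimes> u \<in> M"
        using K by (simp add: flow_kernel_def)
      then have "(g [^] i \<otimes> u) \<otimes> inv u \<in> M"
        by (rule M.m_closed[OF _ M.m_inv_closed[OF uM]])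
      then have giM: "g [^] i \<in> M"
        using uF gi by (simp add: m_assoc)
      \<comment> \<open>Since conjugation by \<open>g\<close> fixes g^i, the flow of g^i is
        invariant under \<open>g\<close>; modulo \<open>n\<close> the flow of \<open>u\<close> is
        its negative.\<close>
      have comm: "g \<otimes> g [^] i \<otimes> inv g = g [^] i"
      proof -
        have "g \<otimes> g [^] i = g [^] i \<otimes> g"
          using g int_pow_mult[OF g(1), of 1 i] int_pow_mult[OF g(1), of i 1] by (simp add: add.commute)
        then show ?thesis using g by (simp add: m_assoc)
      qed
      have flow_g: "flow M u x (g \<otimes> y) = flow M u x y" if y: "y \<in> carrier F" for y
      proof -
        have dvd: "int n dvd flow M (g [^] i) x z + flow M u x z" if z: "z \<in> carrier F" for z
        proof -
          have "int n dvd flow M (g [^] i \<otimes> u) x z"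
            using K xv(1) z unfolding flow_kernel_def by blast
          then show ?thesis using flow_mult_normal[OF M(1) giM uF z] by simp
        qed
        have "flow M (g [^] i) x (g \<otimes> y) = flow M (g [^] i) x y"
          using flow_conj_normal[OF M(1) giM g(1), of "g \<otimes> y" x] g y by (simp add: comm)
        then have "int n dvd flow M u x (g \<otimes> y) - flow M u x y"
          using dvd_diff[OF dvd[of "g \<otimes> y"] dvd[OF y]] g y by simp
        moreover have "\<bar>flow M u x (g \<otimes> y) - flow M u x y\<bar> < int n"
          using abs_flow_le[of M u x "g \<otimes> y"] abs_flow_le[of M u x y] by (simp add: n_def)
        ultimately show ?thesis
          using dvd_imp_le_int[of "flow M u x (g \<otimes> y) - flow M u x y" "int n"] by force
      qed
      have "flow M u x (g [^] j \<otimes> p) = flow M u x p" for j :: nat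
      proof (induction j)
        case (Suc j)
        have "g [^] Suc j \<otimes> p = g \<otimes> (g [^] j \<otimes> p)"
          unfolding nat_pow_Suc2[OF g(1)] using g pF by (simp add: m_assoc)
        moreover have "flow M u x (g \<otimes> (g [^] j \<otimes> p)) = flow M u x (g [^] j \<otimes> p)"
          using g pF by (intro flow_g) simp
        ultimately show ?case using Suc by simp
      qed (use pF in simp)
      then have "\<exists>q\<in>W. inv q \<otimes> (g [^] j \<otimes> p) \<in> M" for j :: nat
        using flow_nonzero[OF uF, of "g [^] j \<otimes> p" M x] p0 g pF unfolding W_def by (metis m_closed nat_pow_closed)
      then obtain f where f: "\<And>j::nat. f j \<in> W \<and> inv (f j) \<otimes> (g [^] j \<otimes> p) \<in> M"
        by metis
      \<comment> \<open>Pigeonhole: the translates of \<open>p\<close> by g^0, ..., g^card W all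
        fall into cosets represented in \<open>W\<close>, one fewer than there are
        exponents.\<close>
      have "\<not> inj_on f {..card W}"
        using f W(1) card_inj_on_le[of f "{..card W}" W] by force
      then obtain j k where jk: "j < k" "k \<le> card W" "f j = f k"
        unfolding inj_on_def by (metis atMost_iff linorder_neqE_nat)
      define q where "q = f j"
      have qF: "q \<in> carrier F" using f W(2) by (auto simp: q_def)
      have "inv (inv q \<otimes> (g [^] j \<otimes> p)) \<otimes> (inv q \<otimes> (g [^] k \<otimes> p)) \<in> M"
        using f[of j] f[of k] jk(3) by (auto simp: q_def)
      moreover have "g [^] k = g [^] j \<otimes> g [^] (k - j)"
        using g jk(1) by (simp add: nat_pow_mult)
      ultimately have "inv p \<otimes> (g [^] (k - j) \<otimes> p) \<in> M"
        using qF pF g by (simp add: inv_mult_group m_assoc)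
      then have "p \<otimes> (inv p \<otimes> (g [^] (k - j) \<otimes> p)) \<otimes> inv p \<in> M"
        using pF by (intro M.inv_op_closed2)
      then have "g [^] (k - j) \<in> M"
        using pF g by (simp add: m_assoc)
      moreover have "k - j \<in> {1..card W}"
        using jk by auto
      then have "g [^] int (k - j) \<in> S"
        unfolding S_def by (rule imageI)
      ultimately show False using M(4) unfolding int_pow_int by blast
    qed
  qed (simp add: n_def)
qed

lemma cyclic_separable_mod_derived:
  assumes N: "N \<lhd> F" "cyclic_separable_mod N" and tf: "torsion_free_mod N"
  shows "cyclic_separable_mod (derived F N)"
  unfolding cyclic_separable_mod_def
proof (intro ballI impI)
  fix g h assume g: "g \<in> carrier F" and h: "h \<in> carrier F" and
    sep: "\<forall>i::int. g [^] i \<otimes> h \<notin> derived F N"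
  interpret N: normal N F by fact
  have DN: "derived F N \<subseteq> N"
    by (rule derived_incl[OF subset_refl N.subgroup_axioms])
  show "\<exists>M. M \<lhd> F \<and> derived F N \<subseteq> M \<and> in_class \<C> (F Mod M) \<and> (\<forall>i::int. g [^] i \<otimes> h \<notin> M)"
  proof (cases "\<forall>i::int. g [^] i \<otimes> h \<notin> N")
    case True
    then obtain M where "M \<lhd> F \<and> N \<subseteq> M \<and> in_class \<C> (F Mod M) \<and> (\<forall>i::int. g [^] i \<otimes> h \<notin> M)"
      using N(2) g h unfolding cyclic_separable_mod_def by blast
    then show ?thesis using DN by blast
  next
    case False
    then obtain m :: int where m: "g [^] m \<otimes> h \<in> N" by blast
    \<comment> \<open>Passing from \<open>h\<close> to \<open>u\<close> only reindexes the powers of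
      \<open>g\<close>, and the path of \<open>u\<close> is closed modulo \<open>N\<close>.\<close>
    define u where "u = g [^] m \<otimes> h"
    have shift: "g [^] i \<otimes> u = g [^] (i + m) \<otimes> h" for i :: int
      using g h by (simp add: u_def int_pow_mult m_assoc)
    have u: "u \<in> N" "g [^] i \<otimes> u \<notin> flow_kernel N 0" for i :: int
      using m sep unfolding shift derived_eq_flow_kernel[OF N(1) finite_X] by (simp_all add: u_def)
    obtain M n where M: "M \<lhd> F" "N \<subseteq> M" "in_class \<C> (F Mod M)" "n > 0"
      "\<And>i::int. g [^] i \<otimes> u \<notin> flow_kernel M (int n)"
    proof (cases "g \<in> N")
      case True
      show thesis by (rule separate_normal[OF N True u(1) u(2)]) (rule that)
    next
      case False
      have u0: "u \<notin> flow_kernel N 0"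
        using u(2)[of 0] u(1) N.subset by (simp add: subset_iff)
      show thesis by (rule separate_non_normal[OF N tf g False u(1) u0]) (rule that)
    qed
    have "derived F N \<subseteq> flow_kernel M (int n)"
      using mono_derived[OF M(2)] derived_subset_flow_kernel[OF M(1)] by blast
    moreover have "g [^] i \<otimes> h \<notin> flow_kernel M (int n)" for i :: int
      using M(5)[of "i - m"] shift[of "i - m"] by simp
    ultimately show ?thesis
      using normal_flow_kernel[OF M(1)] in_class_Mod_flow_kernel[OF M(1,3,4)] by blast
  qed
qed

lemma exp_of_derived_separable: "cyclic_separable_mod ((derived F ^^ k) (carrier F))"
proof (induction k)
  case 0
  \<comment> \<open>Vacuous, since every g^i h lies in \<open>carrier F\<close>.\<close>
  show ?case by (simp add: cyclic_separable_mod_def)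
next
  case (Suc k)
  then show ?case
    using exp_of_derived_normal_torsion_free[OF finite_X, of k] cyclic_separable_mod_derived by simp
qed

end

section \<open>Closed cyclic subgroups\<close>

context extension_closed_pseudovariety
begin

text \<open>The separating subgroup of F/L is M/L, called \<open>?R\<close>: if its coset at
  \<open>d\<close> met the subgroup generated by \<open>c\<close>, then some g^i h would lie in
  \<open>M\<close>.\<close>

lemma cyclic_subgroup_separable_Mod:
  assumes "L \<lhd> F"
    and sep: "\<And>g h. g \<in> carrier F \<Longrightarrow> h \<in> carrier F \<Longrightarrow> \<forall>i::int. g [^]\<^bsub>F\<^esub> i \<otimes>\<^bsub>F\<^esub> h \<notin> L \<Longrightarrow>
      \<exists>M. M \<lhd> F \<and> L \<subseteq> M \<and> in_class \<C> (F Mod M) \<and> (\<forall>i::int. g [^]\<^bsub>F\<^esub> i \<otimes>\<^bsub>F\<^esub> h \<notin> M)"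
  shows "cyclic_subgroup_separable \<C> (F Mod L)"
  unfolding cyclic_subgroup_separable_def
proof
  interpret L: normal L F by fact
  let ?G = "F Mod L"
  interpret G: group ?G by (rule L.factorgroup_is_group)
  fix c assume c: "c \<in> carrier ?G"
  then obtain g where g: "g \<in> carrier F" "c = L #>\<^bsub>F\<^esub> g"
    by (auto simp: carrier_FactGroup)
  have gen: "generate ?G {c} = range (\<lambda>i::int. L #>\<^bsub>F\<^esub> (g [^]\<^bsub>F\<^esub> i))"
    using G.generate_pow[OF c] L.FactGroup_int_pow[OF g(1)] by (auto simp: g(2))
  show "closedin (pro_topology \<C> ?G) (generate ?G {c})"
    unfolding closedin_pro_topology_iff[OF G.is_group]
  proof (intro conjI ballI)
    show "generate ?G {c} \<subseteq> carrier ?G"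
      using c by (intro G.generate_incl) simp
  next
    fix d assume d: "d \<in> carrier ?G - generate ?G {c}"
    then obtain h where h: "h \<in> carrier F" "d = L #>\<^bsub>F\<^esub> h"
      by (auto simp: carrier_FactGroup)
    have "g [^]\<^bsub>F\<^esub> i \<otimes>\<^bsub>F\<^esub> h \<notin> L" for i :: int
    proof
      assume "g [^]\<^bsub>F\<^esub> i \<otimes>\<^bsub>F\<^esub> h \<in> L"
      then have "inv\<^bsub>F\<^esub> (g [^]\<^bsub>F\<^esub> i) \<otimes>\<^bsub>F\<^esub> (g [^]\<^bsub>F\<^esub> i \<otimes>\<^bsub>F\<^esub> h) \<otimes>\<^bsub>F\<^esub> g [^]\<^bsub>F\<^esub> i \<in> L"
        using g by (intro L.inv_op_closed1) auto
      then have "h \<otimes>\<^bsub>F\<^esub> g [^]\<^bsub>F\<^esub> i \<in> L"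
        using g h by (simp add: L.m_assoc[symmetric])
      then have "h \<in> L #>\<^bsub>F\<^esub> (g [^]\<^bsub>F\<^esub> (- i))"
        unfolding r_coset_def using g h
        by (auto simp: L.int_pow_neg L.m_assoc intro!: bexI[of _ "h \<otimes>\<^bsub>F\<^esub> g [^]\<^bsub>F\<^esub> i"])
      then have "d = L #>\<^bsub>F\<^esub> (g [^]\<^bsub>F\<^esub> (- i))"
        using L.repr_independence[OF _ _ L.subgroup_axioms, of h "g [^]\<^bsub>F\<^esub> (- i)"] g h by simp
      then show False using d unfolding gen by blast
    qed
    then obtain M where M: "M \<lhd> F" "L \<subseteq> M" "in_class \<C> (F Mod M)"
      "\<And>i::int. g [^]\<^bsub>F\<^esub> i \<otimes>\<^bsub>F\<^esub> h \<notin> M"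
      using sep[OF g(1) h(1)] by blast
    interpret M: normal M F by (rule M)
    let ?R = "rcosets\<^bsub>F\<lparr>carrier := M\<rparr>\<^esub> L"
    have R: "?R \<lhd> ?G"
      by (rule L.normality_factorization[OF assms(1) M(2,1)])
    have "in_class \<C> (?G Mod ?R)"
      using in_class_iso[OF M(3) L.third_isomorphism[OF assms(1) M(1,2)]]
        normal.factorgroup_is_group[OF R] .
    moreover have "e \<notin> generate ?G {c}" if e: "e \<in> d <#\<^bsub>?G\<^esub> ?R" for e
    proof
      assume "e \<in> generate ?G {c}"
      then obtain i :: int where i: "e = L #>\<^bsub>F\<^esub> (g [^]\<^bsub>F\<^esub> i)"
        unfolding gen by blast
      obtain m where m: "m \<in> M" "e = d \<otimes>\<^bsub>?G\<^esub> (L #>\<^bsub>F\<^esub> m)"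
        using e unfolding l_coset_def RCOSETS_def by auto
      have mF: "m \<in> carrier F" using m M.subset by blast
      have "e = L #>\<^bsub>F\<^esub> (h \<otimes>\<^bsub>F\<^esub> m)"
        using m(2) h mF by (simp add: L.rcos_sum)
      then have "h \<otimes>\<^bsub>F\<^esub> m \<in> L #>\<^bsub>F\<^esub> (g [^]\<^bsub>F\<^esub> i)"
        using i L.rcos_self[OF _ L.subgroup_axioms, of "h \<otimes>\<^bsub>F\<^esub> m"] h mF by simp
      then obtain l where l: "l \<in> L" "h \<otimes>\<^bsub>F\<^esub> m = l \<otimes>\<^bsub>F\<^esub> g [^]\<^bsub>F\<^esub> i"
        unfolding r_coset_def by blast
      have lM: "l \<in> M" "l \<in> carrier F" using l M.subset M(2) by auto
      have "h = l \<otimes>\<^bsub>F\<^esub> g [^]\<^bsub>F\<^esub> i \<otimes>\<^bsub>F\<^esub> inv\<^bsub>F\<^esub> m"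
        using l(2) h mF by (metis L.inv_solve_right L.m_closed)
      then have "g [^]\<^bsub>F\<^esub> (- i) \<otimes>\<^bsub>F\<^esub> h =
          inv\<^bsub>F\<^esub> (g [^]\<^bsub>F\<^esub> i) \<otimes>\<^bsub>F\<^esub> l \<otimes>\<^bsub>F\<^esub> g [^]\<^bsub>F\<^esub> i \<otimes>\<^bsub>F\<^esub> inv\<^bsub>F\<^esub> m"
        using g lM mF by (simp add: L.int_pow_neg L.m_assoc)
      moreover have "inv\<^bsub>F\<^esub> (g [^]\<^bsub>F\<^esub> i) \<otimes>\<^bsub>F\<^esub> l \<otimes>\<^bsub>F\<^esub> g [^]\<^bsub>F\<^esub> i \<in> M"
        using M.inv_op_closed1[OF _ lM(1)] g by simp
      ultimately show False
        using M(4)[of "- i"] M.m_closed[OF _ M.m_inv_closed[OF m(1)]] by simp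
    qed
    ultimately show "\<exists>N. N \<lhd> ?G \<and> in_class \<C> (?G Mod N) \<and> (d <#\<^bsub>?G\<^esub> N) \<inter> generate ?G {c} = {}"
      using R by blast
  qed
qed

text \<open>For 0 < i < n the power x^i is not a power of x^n. One normal subgroup \<open>K\<close>
  separates all these elements, which makes the order \<open>m\<close> of \<open>x\<close> modulo
  \<open>K\<close> a multiple of \<open>n\<close>. A suitable power of \<open>x\<close> then has
  order exactly \<open>n\<close> in G/K.\<close>

lemma in_class_integer_mod_group_if_separable:
  assumes "group G" "x \<in> carrier G" and inf: "\<And>i::int. i \<noteq> 0 \<Longrightarrow> x [^]\<^bsub>G\<^esub> i \<noteq> \<one>\<^bsub>G\<^esub>"
    and sep: "cyclic_subgroup_separable \<C> G" and n: "n > 0"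
  shows "in_class \<C> (integer_mod_group n)"
proof -
  interpret G: group G by fact
  note x = assms(2)
  have gen: "generate G {x [^]\<^bsub>G\<^esub> int n} = range (\<lambda>k::int. x [^]\<^bsub>G\<^esub> (int n * k))"
    using G.generate_pow[of "x [^]\<^bsub>G\<^esub> int n"] x by (auto simp: G.int_pow_pow)
  have "\<exists>N. N \<lhd> G \<and> in_class \<C> (G Mod N) \<and>
      (x [^]\<^bsub>G\<^esub> int i <#\<^bsub>G\<^esub> N) \<inter> generate G {x [^]\<^bsub>G\<^esub> int n} = {}" if i: "i \<in> {0<..<n}" for i
  proof -
    have "x [^]\<^bsub>G\<^esub> int i \<noteq> x [^]\<^bsub>G\<^esub> (int n * k)" for k :: int
    proof
      assume "x [^]\<^bsub>G\<^esub> int i = x [^]\<^bsub>G\<^esub> (int n * k)"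
      then have "x [^]\<^bsub>G\<^esub> (int i - int n * k) = \<one>\<^bsub>G\<^esub>"
        using x by (simp add: G.int_pow_diff)
      then have "int i - int n * k = 0" using inf by blast
      then have "int n dvd int i" by simp
      then show False using i by (auto dest: nat_dvd_not_less)
    qed
    then have "x [^]\<^bsub>G\<^esub> int i \<in> carrier G - generate G {x [^]\<^bsub>G\<^esub> int n}"
      using x unfolding gen by auto
    moreover have "closedin (pro_topology \<C> G) (generate G {x [^]\<^bsub>G\<^esub> int n})"
      using sep x unfolding cyclic_subgroup_separable_def by blast
    ultimately show ?thesis
      unfolding closedin_pro_topology_iff[OF assms(1)] by blast
  qed
  then obtain N where N: "\<And>i. i \<in> {0<..<n} \<Longrightarrow> N i \<lhd> G \<and> in_class \<C> (G Mod N i) \<and>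
      (x [^]\<^bsub>G\<^esub> int i <#\<^bsub>G\<^esub> N i) \<inter> generate G {x [^]\<^bsub>G\<^esub> int n} = {}"
    by metis
  define K where "K = carrier G \<inter> (\<Inter>i\<in>{0<..<n}. N i)"
  have K: "K \<lhd> G" "in_class \<C> (G Mod K)"
    using in_class_Mod_INT[of "{0<..<n}" G N] N assms(1) by (auto simp: K_def)
  interpret K: normal K G by (rule K)
  interpret Q: group "G Mod K" by (rule K.factorgroup_is_group)
  define y where "y = K #>\<^bsub>G\<^esub> x"
  have y: "y \<in> carrier (G Mod K)"
    using x by (auto simp: y_def carrier_FactGroup)
  define m where "m = Q.ord y"
  have "m > 0"
    using Q.ord_ge_1[OF in_class_finite[OF K(2)] y] by (simp add: m_def)
  have "n dvd m"
  proof (rule ccontr)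
    assume "\<not> n dvd m"
    \<comment> \<open>For this \<open>i\<close>, x^-m lies in \<open>K\<close>, so x^i x^-m lies in
      the coset of \<open>N i\<close> at x^i; but it is also a power of x^n.\<close>
    define i where "i = m mod n"
    have i: "i \<in> {0<..<n}"
      using n \<open>\<not> n dvd m\<close> by (auto simp: i_def dvd_eq_mod_eq_0)
    have "y [^]\<^bsub>G Mod K\<^esub> (- int m) = \<one>\<^bsub>G Mod K\<^esub>"
      using Q.int_pow_eq_id[OF y] by (simp add: m_def)
    then have "K #>\<^bsub>G\<^esub> (x [^]\<^bsub>G\<^esub> (- int m)) = K"
      using K.FactGroup_int_pow[OF x] by (simp add: y_def)
    then have "x [^]\<^bsub>G\<^esub> (- int m) \<in> K"
      using G.coset_join1[OF _ _ K.subgroup_axioms] x by blast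
    then have "x [^]\<^bsub>G\<^esub> (- int m) \<in> N i"
      using i by (simp add: K_def)
    then have "x [^]\<^bsub>G\<^esub> int i \<otimes>\<^bsub>G\<^esub> x [^]\<^bsub>G\<^esub> (- int m) \<in> x [^]\<^bsub>G\<^esub> int i <#\<^bsub>G\<^esub> N i"
      unfolding l_coset_def by blast
    moreover have "int m = int n * int (m div n) + int i"
      unfolding i_def by (metis mult_div_mod_eq of_nat_add of_nat_mult)
    then have "int i + (- int m) = int n * (- int (m div n))"
      by simp
    then have "x [^]\<^bsub>G\<^esub> int i \<otimes>\<^bsub>G\<^esub> x [^]\<^bsub>G\<^esub> (- int m) = x [^]\<^bsub>G\<^esub> (int n * (- int (m div n)))"
      using G.int_pow_mult[OF x, of "int i" "- int m"] by simp
    ultimately show False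
      using N[OF i] unfolding gen by blast
  qed
  then obtain d where d: "m = n * d" by blast
  define z where "z = y [^]\<^bsub>G Mod K\<^esub> int d"
  have z: "z \<in> carrier (G Mod K)" using y by (simp add: z_def)
  have "int (Q.ord z) dvd i \<longleftrightarrow> int n dvd i" for i
  proof -
    have "int (Q.ord z) dvd i \<longleftrightarrow> int m dvd int d * i"
      using Q.int_pow_eq_id[OF z, of i] Q.int_pow_eq_id[OF y, of "int d * i"] y
      by (simp add: z_def m_def Q.int_pow_pow)
    also have "\<dots> \<longleftrightarrow> int n dvd i"
      using \<open>m > 0\<close> d by (simp add: mult.commute[of "int n"])
    finally show ?thesis .
  qed
  then have "Q.ord z = n"
    by (metis dvd_refl dvd_antisym of_nat_dvd_iff)
  then show ?thesis
    using in_class_mon[OF Q.mon_integer_mod_group_pow[OF z] _ K(2)] n by simp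
qed

end

section \<open>The equivalence for free solvable groups\<close>

theorem corollary6p14:
  fixes r k :: nat
  assumes "r \<ge> 1" and "k \<ge> 1"
  shows "(\<forall>\<C>. extension_closed_pseudovariety \<C> \<longrightarrow>
            (cyclic_subgroup_separable \<C> (free_solvable_group r k)
              \<longleftrightarrow> finite_cyclic_groups \<subseteq> \<C>))
         \<and> cyclic_subgroup_separable finite_groups (free_solvable_group r k)"
proof -
  define F where "F = free_group {..<r}"
  interpret F: free_group_on "{..<r}" F
    by unfold_locales (rule F_def)
  define L where "L = (derived F ^^ k) (carrier F)"
  have S: "free_solvable_group r k = F Mod L"
    by (simp add: free_solvable_group_def F_def L_def Let_def)
  have L: "L \<lhd> F" "F.torsion_free_mod L"
    using F.exp_of_derived_normal_torsion_free[of k] by (simp_all add: L_def)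
  interpret L: normal L F by (rule L)
  interpret Q: group "F Mod L" by (rule L.factorgroup_is_group)
  have sep: "cyclic_subgroup_separable \<C> (F Mod L)"
    if "extension_closed_pseudovariety \<C>" "finite_cyclic_groups \<subseteq> \<C>" for \<C>
  proof -
    interpret extension_closed_pseudovariety \<C> by fact
    interpret P: free_group_pseudovariety "{..<r}" F \<C>
      by unfold_locales (use that in auto)
    show ?thesis
      using P.exp_of_derived_separable[of k] unfolding P.cyclic_separable_mod_def L_def[symmetric]
      by (intro cyclic_subgroup_separable_Mod[OF L(1)]) blast
  qed
  \<comment> \<open>A free generator, available because r is positive; its image will be shown to
    have infinite order.\<close>
  define g where "g = [(0::nat, True)]"
  have g: "g \<in> carrier F"
    using assms(1) by (simp add: g_def F.letter_closed)
  \<comment> \<open>Modulo all of F the Cayley graph has a single vertex and the flow is the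
    exponent sum of a generator. It is 1 for \<open>g\<close>, so \<open>g\<close> is not in the
    derived subgroup.\<close>
  have "\<not> 0 dvd flow (carrier F) g 0 []" "0 \<in> {..<r}"
    using assms(1) by (simp_all add: g_def)
  then have "g \<notin> F.flow_kernel (carrier F) 0"
    using F.Nil_closed unfolding F.flow_kernel_def by blast
  \<comment> \<open>Here k >= 1 matters: for k = 0 the quotient would be trivial.\<close>
  moreover have "L \<subseteq> derived F (carrier F)"
  proof -
    obtain j where "k = Suc j" using assms(2) by (cases k) auto
    then show ?thesis
      using F.mono_derived[OF F.exp_of_derived_in_carrier[OF subset_refl]] by (simp add: L_def)
  qed
  ultimately have "g \<notin> L"
    using F.derived_eq_flow_kernel[OF F.normal_self] by auto
  have inf: "(L #>\<^bsub>F\<^esub> g) [^]\<^bsub>F Mod L\<^esub> i \<noteq> \<one>\<^bsub>F Mod L\<^esub>" if "i \<noteq> 0" for i :: int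
  proof
    assume "(L #>\<^bsub>F\<^esub> g) [^]\<^bsub>F Mod L\<^esub> i = \<one>\<^bsub>F Mod L\<^esub>"
    then have "L #>\<^bsub>F\<^esub> (g [^]\<^bsub>F\<^esub> i) = L"
      by (simp add: L.FactGroup_int_pow[OF g])
    then have "g [^]\<^bsub>F\<^esub> i \<in> L"
      by (rule F.coset_join1[OF _ F.int_pow_closed[OF g] L.subgroup_axioms])
    then show False
      using L(2) g \<open>i \<noteq> 0\<close> \<open>g \<notin> L\<close> unfolding F.torsion_free_mod_def by blast
  qed
  have nec: "finite_cyclic_groups \<subseteq> \<C>"
    if "extension_closed_pseudovariety \<C>" "cyclic_subgroup_separable \<C> (F Mod L)" for \<C>
  proof -
    interpret extension_closed_pseudovariety \<C> by fact
    have "L #>\<^bsub>F\<^esub> g \<in> carrier (F Mod L)"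
      using g by (simp add: carrier_FactGroup)
    then show ?thesis
      using in_class_integer_mod_group_if_separable[OF Q.is_group _ inf that(2)]
      by (intro finite_cyclic_groups_subset) blast
  qed
  have "cyclic_subgroup_separable finite_groups (F Mod L)"
    by (intro sep extension_closed_pseudovariety_finite_groups)
       (auto simp: finite_cyclic_groups_def finite_groups_def)
  then show ?thesis
    unfolding S using sep nec by blast
qed

end
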